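(* For every $n$ let the distribution $P_n^x$ of $x_{n+1}$ be nonatomic, let $\mathcal{A}$ be a symmetric prediction algorithm, and denote by $PI^{J}_{\mathcal{A},n,\alpha}(\delta)$ the associated ($\delta$-inflated) symmetrized Jackknife prediction interval. Let $\mathcal{B}$ be the algorithm constructed from $\mathcal{A}$ as described in the context, let $\mathfrak{C}$ be the family of conformity scores given by the absolute in-sample prediction error $\mathcal{C}^{\mathrm{in}}$ based on $\mathcal{B}$, and let $PS^{\mathrm{fc}}_{\mathcal{B},n,\alpha}(\delta)$ and $PS^{\mathrm{sc}}_{\mathcal{B},n,\alpha}(\delta)$ be the full conformal and shortcut prediction sets for $\mathfrak{C}$. If $\mathcal{A}$ is asymptotically out-of-sample stable, then $PI^J_{\mathcal{A},n,\alpha}(\delta)$ coincides almost surely with the shortcut set $PS^{\mathrm{sc}}_{\mathcal{B},n,\alpha}(\delta)$, and $\mathfrak{C}$ is stable. Consequently $PS^{\mathrm{fc}}_{\mathcal{B}}$ is asymptotically equivalent to $PI^J_{\mathcal{A}}$ in the following sense: (i) The statement "for all $\delta,\epsilon>0$: $\lim_{n\to\infty}\mathbb{P}\big(\sup_{\alpha\in[0,1]}[\mathbb{P}(y_{n+1}\notin PS^{\mathrm{fc}}_{\mathcal{B},n,\alpha}(\delta)\,\|\,\mathcal{T}_n)-\alpha]\ge\epsilon\big)=0$" holds if and only if the same statement holds with $PS^{\mathrm{fc}}_{\mathcal{B},n,\alpha}(\delta)$ replaced by $PI^J_{\mathcal{A},n,\alpha}(\delta)$. (ii) If, additionally, the continuous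 case assumption CC is fulfilled for $\mathfrak{C}$, then $\lim_{n\to\infty}\mathbb{E}\big(\sup_{\alpha\in[0,1]}|\mathbb{P}(y_{n+1}\notin PS^{\mathrm{fc}}_{\mathcal{B},n,\alpha}(0)\,\|\,\mathcal{T}_n)-\alpha|\big)=0$ if and only if the same holds with $PS^{\mathrm{fc}}_{\mathcal{B},n,\alpha}(0)$ replaced by $PI^J_{\mathcal{A},n,\alpha}(0)$.
   Context: Setting. For every $n\in\mathbb{N}$, $P_n$ is a regular Borel probability measure on $\mathcal{Z}_n=\mathcal{Y}_n\times\mathcal{X}_n$, where $\mathcal{Y}_n\subseteq\mathbb{R}$ is a (possibly unbounded) interval and $\mathcal{X}_n$ is a Euclidean space of dimension $p_n\in\mathbb{N}$. For each $n$, $t_i=t_i^{(n)}=(y_i,x_i)$, $1\le i\le n+1$, are i.i.d. with distribution $P_n$. Put $\mathcal{T}_n=(t_1,\dots,t_n)$, and let $\mathcal{T}_n^{\setminus i}$ be $\mathcal{T}_n$ with $t_i$ removed. $\mathbb{P}(\cdot\,\|\,\mathcal{T}_n)$ is conditional probability given $\mathcal{T}_n$. Prediction algorithms. A prediction algorithm is a family $\mathcal{A}=(\mathcal{A}_{n,m})_{n,m\in\mathbb{N}}$ of measurable functions $\mathcal{A}_{n,m}:\mathcal{X}_n\times\mathcal{Z}_n^m\to\mathcal{Y}_n$; it is symmetric if it is invariant under permutations of the training points. A symmetric $\mathcal{A}$ is asymptotically out-of-sample stable if $\mathcal{A}_{n,n}(x_{n+1},\mathcal{T}_n)-\mathcal{A}_{n,n-1}(x_{n+1},\mathcal{T}_n^{\setminus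 n})\to0$ in probability. The algorithm $\mathcal{B}$. For $m\ge2$, $x\in\mathcal{X}_n$ and $T=((y'_1,x'_1),\dots,(y'_m,x'_m))\in\mathcal{Z}_n^m$, let $I(x)=\{i\in\{1,\dots,m\}:x'_i=x\}$ and $T^{\setminus i}$ be $T$ without its $i$-th entry; then $$\mathcal{B}_{n,m}(x,T)=\begin{cases}\frac{1}{|I(x)|}\sum_{i\in I(x)}\mathcal{A}_{n,m-1}(x,T^{\setminus i})&\text{if }I(x)\ne\emptyset,\\ \mathcal{A}_{n,m}(x,T)&\text{else}\end{cases}$$ (for $m=1$ put $\mathcal{B}_{n,1}=\mathcal{A}_{n,1}$, which is immaterial). Conformity score. For $T\in\mathcal{Z}_n^m$, $\mathcal{C}_m((y,x),T)=\mathcal{C}^{\mathrm{in}}_m((y,x),T)=|y-\mathcal{B}_{n,m+1}(x,T\cup(y,x))|$, where $T\cup(y,x)\in\mathcal{Z}_n^{m+1}$ is $T$ with $(y,x)$ appended. $\mathfrak{C}$ is stable if $|\mathcal{C}_n(t_{n+1},\mathcal{T}_n)-\mathcal{C}_{n-1}(t_{n+1},\mathcal{T}_n^{\setminus n})|\to0$ in probability. Continuous case assumption (CC): for every $n$ and almost every $\mathcal{T}_n$, the distribution of $\mathcal{C}_n(t_{n+1},\mathcal{T}_n)$ conditional on $\mathcal{T}_n$ is absolutely continuous with density $f_{\mathcal{T}_n}$, and $(\|f_{\mathcal{T}_n}\|_\infty)_n$ is stochastically bounded, where $\|f\|_\infty=\sup_x|f(x)|$. Quantiles. For a cdf $F$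 and $\alpha\in\mathbb{R}$, $F^{-1}(\alpha)=\inf\{x:F(x)\ge\alpha\}\in[-\infty,\infty]$ with $\inf\emptyset=+\infty$. For real $c$, $c\le+\infty$ is true and $c\le-\infty$ is false. Full conformal sets. With $\mathcal{D}_{n+1}^y=(t_1,\dots,t_n,(y,x_{n+1}))$, $\mathcal{D}_{n+1}^y\setminus t_i$ the same with the $i$-th entry removed, and $\hat F_y(s)=\frac{1}{n+1}\mathds{1}\{\mathcal{C}_n((y,x_{n+1}),\mathcal{T}_n)\le s\}+\frac1{n+1}\sum_{i=1}^n\mathds{1}\{\mathcal{C}_n(t_i,\mathcal{D}_{n+1}^y\setminus t_i)\le s\}$: $PS^{\mathrm{fc}}_{\mathcal{B},n,\alpha}(\delta)=\{y\in\mathcal{Y}_n:\mathcal{C}_n((y,x_{n+1}),\mathcal{T}_n)\le\hat F_y^{-1}(1-\alpha)+\delta\}$. Shortcut sets. $PS^{\mathrm{sc}}_{\mathcal{B},n,\alpha}(\delta)=\{y\in\mathcal{Y}_n:\mathcal{C}_n((y,x_{n+1}),\mathcal{T}_n)\le\hat G^{-1}(1-\alpha)+\delta\}$, $\hat G(s)=\frac1n\sum_{i=1}^n\mathds{1}\{\mathcal{C}_{n-1}(t_i,\mathcal{T}_n^{\setminus i})\le s\}$. Symmetrized Jackknife. With $\hat u_i=y_i-\mathcal{A}_{n,n-1}(x_i,\mathcal{T}_n^{\setminus i})$ and $q$ the $(1-\alpha)$-quantile of the empirical cdf of $|\hat u_1|,\dots,|\hat u_n|$, $PI^J_{\mathcal{A},n,\alpha}(\delta)=\{y\in\mathcal{Y}_n:|y-\mathcal{A}_{n,n}(x_{n+1},\mathcal{T}_n)|\le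 q+\delta\}$. *)

theory Defs
  imports "HOL-Probability.Probability"
begin

(* The feature dimension varies with the sample size, so R^p is represented by the extensional
   functions on {1..p}; the product sigma-algebra is the Borel sigma-algebra of R^p. *)

type_synonym feature = "nat \<Rightarrow> real"
type_synonym point = "real \<times> feature"
type_synonym training = "nat \<Rightarrow> point"

definition X_space :: "nat \<Rightarrow> feature measure" where
  "X_space p = (\<Pi>\<^sub>M j\<in>{1..p}. borel)"

definition Z_space :: "real set \<Rightarrow> nat \<Rightarrow> point measure" where
  "Z_space Y p = restrict_space borel Y \<Otimes>\<^sub>M X_space p"

(* Training samples of size m are extensional functions on {1..m}. *)

definition T_space :: "real set \<Rightarrow> nat \<Rightarrow> nat \<Rightarrow> training measure" where
  "T_space Y p m = (\<Pi>\<^sub>M i\<in>{1..m}. Z_space Y p)"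

definition remove_pt :: "nat \<Rightarrow> training \<Rightarrow> nat \<Rightarrow> training" where
  "remove_pt m T i = (\<lambda>j\<in>{1..m - 1}. if j < i then T j else T (j + 1))"

definition append_pt :: "nat \<Rightarrow> training \<Rightarrow> point \<Rightarrow> training" where
  "append_pt m T z = T(m + 1 := z)"

definition sample :: "(nat \<Rightarrow> nat \<Rightarrow> 'w \<Rightarrow> point) \<Rightarrow> nat \<Rightarrow> 'w \<Rightarrow> training" where
  "sample t n \<omega> = (\<lambda>i\<in>{1..n}. t n i \<omega>)"

definition nonatomic :: "'a measure \<Rightarrow> bool" where
  "nonatomic \<mu> \<longleftrightarrow>
     (\<forall>S\<in>sets \<mu>. emeasure \<mu> S > 0 \<longrightarrow>
        (\<exists>B\<in>sets \<mu>. B \<subseteq> S \<and> 0 < emeasure \<mu> B \<and> emeasure \<mu> B < emeasure \<mu> S))"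

definition to_zero_in_prob :: "(nat \<Rightarrow> 'w measure) \<Rightarrow> (nat \<Rightarrow> 'w \<Rightarrow> real) \<Rightarrow> bool" where
  "to_zero_in_prob M X \<longleftrightarrow>
     (\<forall>\<epsilon>>0. (\<lambda>n. measure (M n) {\<omega>\<in>space (M n). \<bar>X n \<omega>\<bar> \<ge> \<epsilon>}) \<longlonglongrightarrow> 0)"

(* Outer measure, because the supremum norm of an arbitrary version of a conditional density
   need not depend measurably on the condition; for measurable X it is just the measure. *)

definition stochastically_bounded :: "(nat \<Rightarrow> 'w measure) \<Rightarrow> (nat \<Rightarrow> 'w \<Rightarrow> ereal) \<Rightarrow> bool" where
  "stochastically_bounded M X \<longleftrightarrow>
     (\<forall>\<epsilon>>0. \<exists>K::real. \<forall>n\<ge>1.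
        outer_measure_of (M n) {\<omega>\<in>space (M n). \<bar>X n \<omega>\<bar> > ereal K} \<le> ennreal \<epsilon>)"

(* kappa is a regular version of the conditional distribution of V given T: the probability that
   V lies in a set E(T) depending on T, conditionally on T, is kappa(T)(E(T)). *)

definition regular_cond_distr ::
    "'w measure \<Rightarrow> 'a measure \<Rightarrow> ('w \<Rightarrow> 'a) \<Rightarrow> 'b measure \<Rightarrow> ('w \<Rightarrow> 'b) \<Rightarrow> ('a \<Rightarrow> 'b measure) \<Rightarrow> bool" where
  "regular_cond_distr M S T N V \<kappa> \<longleftrightarrow>
     \<kappa> \<in> S \<rightarrow>\<^sub>M prob_algebra N \<and>
     (\<forall>B\<in>sets N. AE \<omega> in M.
        measure (\<kappa> (T \<omega>)) B =
        real_cond_exp M (vimage_algebra (space M) T S) (indicator (V -` B \<inter> space M)) \<omega>)"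


(* A n m x T is the prediction at x of the algorithm trained on the m points T, in the n-th model. *)

type_synonym algorithm = "nat \<Rightarrow> nat \<Rightarrow> feature \<Rightarrow> training \<Rightarrow> real"

definition prediction_algorithm :: "(nat \<Rightarrow> real set) \<Rightarrow> (nat \<Rightarrow> nat) \<Rightarrow> algorithm \<Rightarrow> bool" where
  "prediction_algorithm Y p A \<longleftrightarrow>
     (\<forall>n\<ge>1. \<forall>m\<ge>1. (\<lambda>(x, T). A n m x T) \<in>
        X_space (p n) \<Otimes>\<^sub>M T_space (Y n) (p n) m \<rightarrow>\<^sub>M restrict_space borel (Y n))"

definition symmetric_algorithm :: "(nat \<Rightarrow> real set) \<Rightarrow> (nat \<Rightarrow> nat) \<Rightarrow> algorithm \<Rightarrow> bool" where
  "symmetric_algorithm Y p A \<longleftrightarrow>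
     (\<forall>n\<ge>1. \<forall>m\<ge>1. \<forall>x\<in>space (X_space (p n)). \<forall>T\<in>space (T_space (Y n) (p n) m).
        \<forall>\<pi>. \<pi> permutes {1..m} \<longrightarrow> A n m x (T \<circ> \<pi>) = A n m x T)"

definition out_of_sample_stable ::
    "(nat \<Rightarrow> 'w measure) \<Rightarrow> (nat \<Rightarrow> nat \<Rightarrow> 'w \<Rightarrow> point) \<Rightarrow> algorithm \<Rightarrow> bool" where
  "out_of_sample_stable M t A \<longleftrightarrow>
     to_zero_in_prob M (\<lambda>n \<omega>.
       A n n (snd (t n (n + 1) \<omega>)) (sample t n \<omega>) -
       A n (n - 1) (snd (t n (n + 1) \<omega>)) (remove_pt n (sample t n \<omega>) n))"

definition match_set :: "nat \<Rightarrow> feature \<Rightarrow> training \<Rightarrow> nat set" where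
  "match_set m x T = {i\<in>{1..m}. snd (T i) = x}"

definition B_alg :: "algorithm \<Rightarrow> algorithm" where
  "B_alg A n m x T =
     (if m \<ge> 2 \<and> match_set m x T \<noteq> {}
      then (\<Sum>i\<in>match_set m x T. A n (m - 1) x (remove_pt m T i)) / real (card (match_set m x T))
      else A n m x T)"


(* C n m z T is the conformity score of z relative to the m points T, in the n-th model. *)

type_synonym score = "nat \<Rightarrow> nat \<Rightarrow> point \<Rightarrow> training \<Rightarrow> real"

definition in_sample_score :: "algorithm \<Rightarrow> score" where
  "in_sample_score B n m z T = \<bar>fst z - B n (m + 1) (snd z) (append_pt m T z)\<bar>"

definition stable_score ::
    "(nat \<Rightarrow> 'w measure) \<Rightarrow> (nat \<Rightarrow> nat \<Rightarrow> 'w \<Rightarrow> point) \<Rightarrow> score \<Rightarrow> bool" where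
  "stable_score M t C \<longleftrightarrow>
     to_zero_in_prob M (\<lambda>n \<omega>. \<bar>
       C n n (t n (n + 1) \<omega>) (sample t n \<omega>) -
       C n (n - 1) (t n (n + 1) \<omega>) (remove_pt n (sample t n \<omega>) n)\<bar>)"

definition continuous_case ::
    "(nat \<Rightarrow> 'w measure) \<Rightarrow> (nat \<Rightarrow> nat \<Rightarrow> 'w \<Rightarrow> point) \<Rightarrow>
     (nat \<Rightarrow> training \<Rightarrow> point measure) \<Rightarrow> score \<Rightarrow> bool" where
  "continuous_case M t \<kappa> C \<longleftrightarrow>
     (\<exists>f :: nat \<Rightarrow> training \<Rightarrow> real \<Rightarrow> real.
        (\<forall>n T s. f n T s \<ge> 0) \<and>
        (\<forall>n\<ge>1. AE \<omega> in M n.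
           distributed (\<kappa> n (sample t n \<omega>)) lborel (\<lambda>z. C n n z (sample t n \<omega>))
             (\<lambda>s. ennreal (f n (sample t n \<omega>) s))) \<and>
        stochastically_bounded M (\<lambda>n \<omega>. SUP s. ereal \<bar>f n (sample t n \<omega>) s\<bar>))"

definition quantile :: "(real \<Rightarrow> real) \<Rightarrow> real \<Rightarrow> ereal" where
  "quantile F a = Inf (ereal ` {s. F s \<ge> a})"

definition emp_cdf :: "nat \<Rightarrow> (nat \<Rightarrow> real) \<Rightarrow> real \<Rightarrow> real" where
  "emp_cdf n r s = (1 / real n) * (\<Sum>i=1..n. of_bool (r i \<le> s))"


(* Sample size, alpha, delta, training sample and new feature determine the prediction set. *)

type_synonym pred_set = "nat \<Rightarrow> real \<Rightarrow> real \<Rightarrow> training \<Rightarrow> feature \<Rightarrow> real set"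

definition fc_cdf :: "score \<Rightarrow> nat \<Rightarrow> training \<Rightarrow> point \<Rightarrow> real \<Rightarrow> real" where
  "fc_cdf C n T z s =
     (1 / real (n + 1)) * of_bool (C n n z T \<le> s) +
     (1 / real (n + 1)) *
       (\<Sum>i=1..n. of_bool (C n n (T i) (remove_pt (n + 1) (append_pt n T z) i) \<le> s))"

definition full_conformal_set :: "(nat \<Rightarrow> real set) \<Rightarrow> score \<Rightarrow> pred_set" where
  "full_conformal_set Y C n \<alpha> \<delta> T x =
     {y\<in>Y n. ereal (C n n (y, x) T) \<le> quantile (fc_cdf C n T (y, x)) (1 - \<alpha>) + ereal \<delta>}"

definition shortcut_set :: "(nat \<Rightarrow> real set) \<Rightarrow> score \<Rightarrow> pred_set" where
  "shortcut_set Y C n \<alpha> \<delta> T x =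
     {y\<in>Y n. ereal (C n n (y, x) T) \<le>
        quantile (emp_cdf n (\<lambda>i. C n (n - 1) (T i) (remove_pt n T i))) (1 - \<alpha>) + ereal \<delta>}"

definition loo_residual :: "algorithm \<Rightarrow> nat \<Rightarrow> training \<Rightarrow> nat \<Rightarrow> real" where
  "loo_residual A n T i = fst (T i) - A n (n - 1) (snd (T i)) (remove_pt n T i)"

definition jackknife_set :: "(nat \<Rightarrow> real set) \<Rightarrow> algorithm \<Rightarrow> pred_set" where
  "jackknife_set Y A n \<alpha> \<delta> T x =
     {y\<in>Y n. ereal \<bar>y - A n n x T\<bar> \<le>
        quantile (emp_cdf n (\<lambda>i. \<bar>loo_residual A n T i\<bar>)) (1 - \<alpha>) + ereal \<delta>}"

definition cond_miscoverage ::
    "(nat \<Rightarrow> training \<Rightarrow> point measure) \<Rightarrow> pred_set \<Rightarrow> nat \<Rightarrow> real \<Rightarrow> real \<Rightarrow> training \<Rightarrow> real" where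
  "cond_miscoverage \<kappa> PS n \<alpha> \<delta> T =
     measure (\<kappa> n T) {z\<in>space (\<kappa> n T). fst z \<notin> PS n \<alpha> \<delta> T (snd z)}"

definition asymp_conservative ::
    "(nat \<Rightarrow> 'w measure) \<Rightarrow> (nat \<Rightarrow> nat \<Rightarrow> 'w \<Rightarrow> point) \<Rightarrow>
     (nat \<Rightarrow> training \<Rightarrow> point measure) \<Rightarrow> pred_set \<Rightarrow> bool" where
  "asymp_conservative M t \<kappa> PS \<longleftrightarrow>
     (\<forall>\<delta>>0. \<forall>\<epsilon>>0.
        (\<lambda>n. measure (M n) {\<omega>\<in>space (M n).
           (SUP \<alpha>\<in>{0..1}. cond_miscoverage \<kappa> PS n \<alpha> \<delta> (sample t n \<omega>) - \<alpha>) \<ge> \<epsilon>}) \<longlonglongrightarrow> 0)"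

definition asymp_exact ::
    "(nat \<Rightarrow> 'w measure) \<Rightarrow> (nat \<Rightarrow> nat \<Rightarrow> 'w \<Rightarrow> point) \<Rightarrow>
     (nat \<Rightarrow> training \<Rightarrow> point measure) \<Rightarrow> pred_set \<Rightarrow> bool" where
  "asymp_exact M t \<kappa> PS \<longleftrightarrow>
     (\<lambda>n. LINT \<omega>|M n.
        (SUP \<alpha>\<in>{0..1}. \<bar>cond_miscoverage \<kappa> PS n \<alpha> 0 (sample t n \<omega>) - \<alpha>\<bar>)) \<longlonglongrightarrow> 0"

end

theory Submission
  imports Defs
begin

text \<open>
  Since the feature distribution is nonatomic, almost surely no feature occurs twice. At a feature
  that occurs once, the in-sample prediction of the constructed algorithm is the out-of-sample
  prediction of \<open>A\<close> trained on all the other points (\<open>in_sample_score_fresh\<close>). Hence the score of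
  the new point is the absolute residual of \<open>A\<close> at it, and the scores in the shortcut set are the
  absolute leave-one-out residuals: shortcut set and jackknife set coincide, and stability of the
  score follows from stability of \<open>A\<close> by the triangle inequality.

  The full conformal set differs from the jackknife set in its threshold only: the score of the
  \<open>i\<close>-th sample point is computed with the new point in the training set. The resulting change of
  the prediction has, by exchangeability, the same law as the difference in the definition of
  out-of-sample stability (\<open>swap_diff_law\<close>). Therefore, outside a set of atypical new points whose
  expected conditional probability vanishes (\<open>prob_atypical_le\<close>), all but a small fraction of the
  scores move by less than \<open>\<epsilon>\<close>, and the two sets are nested up to replacing the level \<open>\<alpha>\<close> by
  \<open>\<alpha> + h\<close> and the inflation \<open>\<delta>\<close> by \<open>\<delta> - \<epsilon>\<close>, in both directions
  (\<open>jackknife_subset_full_conformal\<close>, \<open>full_conformal_subset_jackknife\<close>). Conditional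
  probabilities are integrated through the disintegration of the joint law of the sample and the
  new point (\<open>joint_law\<close>).

  For the conservative version the loss \<open>\<epsilon>\<close> is taken out of the positive inflation, and the
  supremum over all levels absorbs the shift \<open>h\<close> (\<open>prob_excess_le\<close>). For the exact version there
  is no inflation to spare; there the bounded conditional density of the score shows that deflating
  the jackknife interval by \<open>\<epsilon>\<close> changes its miscoverage by at most a multiple of \<open>\<epsilon>\<close>
  (\<open>misc_jackknife_deflate\<close>, \<open>expectation_deviation_le\<close>).
\<close>

section \<open>Scores in a sample without repeated features\<close>

lemma remove_pt_extensional: "remove_pt (m + 1) T i \<in> extensional {1..m}"
  by (simp add: remove_pt_def)

lemma remove_pt_append_pt_self:
  assumes "T \<in> extensional {1..m}"
  shows "remove_pt (m + 1) (append_pt m T z) (m + 1) = T"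
  using assms by (auto simp: remove_pt_def append_pt_def restrict_def extensional_def fun_eq_iff)

text \<open>The reason for the construction of \<open>B_alg\<close>: at a feature that occurs once, its in-sample error is
  the out-of-sample error of the original algorithm.\<close>

lemma in_sample_score_fresh:
  assumes "1 \<le> m" "T \<in> extensional {1..m}" "\<And>i. i \<in> {1..m} \<Longrightarrow> snd (T i) \<noteq> snd z"
  shows "in_sample_score (B_alg A) n m z T = \<bar>fst z - A n m (snd z) T\<bar>"
proof -
  have "match_set (m + 1) (snd z) (append_pt m T z) = {m + 1}"
    using assms(3) by (force simp: match_set_def append_pt_def)
  moreover have "2 \<le> m + 1"
    using assms(1) by simp
  ultimately have "B_alg A n (m + 1) (snd z) (append_pt m T z) = A n m (snd z) T"
    using remove_pt_append_pt_self[OF assms(2), of z] unfolding B_alg_def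
    by simp
  then show ?thesis
    by (simp add: in_sample_score_def)
qed

text \<open>No two of the first \<open>m\<close> sample points share their feature.\<close>

definition distinct_features :: "nat \<Rightarrow> training \<Rightarrow> bool" where
  "distinct_features m T \<longleftrightarrow> inj_on (\<lambda>i. snd (T i)) {1..m}"

lemma distinct_featuresD:
  "distinct_features m T \<Longrightarrow> i \<in> {1..m} \<Longrightarrow> j \<in> {1..m} \<Longrightarrow> i \<noteq> j \<Longrightarrow> snd (T i) \<noteq> snd (T j)"
  unfolding distinct_features_def using inj_onD[of "\<lambda>i. snd (T i)" "{1..m}" i j] by blast

lemma score_new_point:
  assumes "1 \<le> n" "T \<in> extensional {1..n}" "distinct_features (n + 1) (append_pt n T z)"
  shows "in_sample_score (B_alg A) n n z T = \<bar>fst z - A n n (snd z) T\<bar>"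
proof (rule in_sample_score_fresh)
  fix i assume "i \<in> {1..n}"
  then show "snd (T i) \<noteq> snd z"
    using distinct_featuresD[OF assms(3), of i "n + 1"] by (auto simp: append_pt_def)
qed fact+

lemma score_swapped_point:
  assumes "1 \<le> n" "i \<in> {1..n}" "distinct_features (n + 1) (append_pt n T z)"
  shows "in_sample_score (B_alg A) n n (T i) (remove_pt (n + 1) (append_pt n T z) i) =
    \<bar>fst (T i) - A n n (snd (T i)) (remove_pt (n + 1) (append_pt n T z) i)\<bar>"
proof (rule in_sample_score_fresh)
  fix j assume j: "j \<in> {1..n}"
  define k where "k = (if j < i then j else j + 1)"
  have "remove_pt (n + 1) (append_pt n T z) i j = append_pt n T z k"
    using j by (simp add: remove_pt_def k_def)
  moreover have "T i = append_pt n T z i"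
    using assms(2) by (simp add: append_pt_def)
  moreover have "k \<in> {1..n + 1}" "i \<in> {1..n + 1}" "k \<noteq> i"
    using j assms(2) by (auto simp: k_def)
  ultimately show "snd (remove_pt (n + 1) (append_pt n T z) i j) \<noteq> snd (T i)"
    using distinct_featuresD[OF assms(3)] by metis
qed (use assms remove_pt_extensional in auto)

lemma score_leave_one_out:
  assumes "2 \<le> n" "i \<in> {1..n}" "distinct_features n T"
  shows "in_sample_score (B_alg A) n (n - 1) (T i) (remove_pt n T i) = \<bar>loo_residual A n T i\<bar>"
  unfolding loo_residual_def
proof (rule in_sample_score_fresh)
  fix j assume j: "j \<in> {1..n - 1}"
  define k where "k = (if j < i then j else j + 1)"
  have "remove_pt n T i j = T k"
    using j by (simp add: remove_pt_def k_def)
  moreover have "k \<in> {1..n}" "k \<noteq> i"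
    using j assms(2) by (auto simp: k_def)
  ultimately show "snd (remove_pt n T i j) \<noteq> snd (T i)"
    using distinct_featuresD[OF assms(3)] assms(2) by metis
qed (use assms remove_pt_extensional[of "n - 1" T i] in auto)

lemma distinct_features_append_ptD:
  "distinct_features (n + 1) (append_pt n T z) \<Longrightarrow> distinct_features n T"
  unfolding distinct_features_def
  by (rule inj_onI) (drule inj_onD, auto simp: append_pt_def)

section \<open>Quantiles of empirical distributions\<close>

lemma emp_cdf_mono: "mono (emp_cdf n r)"
  unfolding emp_cdf_def
  by (intro monoI mult_left_mono sum_mono) auto

lemma fc_cdf_mono: "mono (fc_cdf C n T z)"
  unfolding fc_cdf_def
  by (intro monoI add_mono mult_left_mono sum_mono) auto

lemma quantile_antimono: "a \<le> b \<Longrightarrow> quantile F a \<le> quantile F b"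
  unfolding quantile_def by (intro Inf_superset_mono) auto

text \<open>An inequality between distribution functions up to a shift \<open>e\<close> of the argument and \<open>h\<close> of the value
  is inherited by the quantiles, with the two shifts interchanged.\<close>

lemma quantile_shift_le:
  assumes "\<And>s. F s \<le> G (s + e) + h"
  shows "quantile G (a - h) \<le> quantile F a + ereal e"
proof -
  have "quantile G (a - h) - ereal e \<le> quantile F a"
    unfolding quantile_def[of F]
  proof (rule Inf_greatest, clarify)
    fix s assume "a \<le> F s"
    then have "a - h \<le> G (s + e)" using assms[of s] by simp
    then have "quantile G (a - h) \<le> ereal (s + e)"
      unfolding quantile_def by (intro Inf_lower) auto
    then show "quantile G (a - h) - ereal e \<le> ereal s"
      by (simp add: ereal_minus_le_iff add.commute)
  qed
  then show ?thesis by (simp add: ereal_minus_le_iff add.commute)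
qed

text \<open>A countable infimum, which makes the quantile a measurable function of the distribution.\<close>

lemma quantile_eq_INF_rational:
  assumes "mono F"
  shows "quantile F a = (INF q\<in>\<rat>. if a \<le> F q then ereal q else \<infinity>)"
proof (rule antisym)
  show "quantile F a \<le> (INF q\<in>\<rat>. if a \<le> F q then ereal q else \<infinity>)"
    unfolding quantile_def by (intro INF_greatest) (auto intro: Inf_lower)
  show "(INF q\<in>\<rat>. if a \<le> F q then ereal q else \<infinity>) \<le> quantile F a"
    unfolding quantile_def
  proof (rule Inf_greatest, clarify)
    fix s assume s: "a \<le> F s"
    show "(INF q\<in>\<rat>. if a \<le> F q then ereal q else \<infinity>) \<le> ereal s"
    proof (rule ereal_le_epsilon2)
      fix e :: real assume "0 < e"
      then obtain q where q: "q \<in> \<rat>" "s < q" "q < s + e"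
        using Rats_dense_in_real[of s "s + e"] by auto
      then have "a \<le> F q"
        using s monoD[OF assms, of s q] by simp
      then have "(INF q\<in>\<rat>. if a \<le> F q then ereal q else \<infinity>) \<le> ereal q"
        using q(1) by (intro INF_lower2[of q]) auto
      also have "\<dots> \<le> ereal s + ereal e"
        using q by simp
      finally show "(INF q\<in>\<rat>. if a \<le> F q then ereal q else \<infinity>) \<le> ereal s + ereal e" .
    qed
  qed
qed

lemma borel_measurable_quantile:
  assumes "\<And>w. mono (F w)" and [measurable]: "\<And>s. (\<lambda>w. F w s) \<in> borel_measurable M"
  shows "(\<lambda>w. quantile (F w) a) \<in> borel_measurable M"
  unfolding quantile_eq_INF_rational[OF assms(1)]
  by (intro borel_measurable_INF countable_rat) measurable

lemma emp_cdf_close: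
  assumes n: "1 \<le> n"
    and few: "real (card {i\<in>{1..n}. \<not> \<bar>a i - b i\<bar> < e}) \<le> h * real n"
  shows "emp_cdf n a s \<le> emp_cdf n b (s + e) + h"
proof -
  let ?N = "{i\<in>{1..n}. \<not> \<bar>a i - b i\<bar> < e}"
  have "(\<Sum>i=1..n. of_bool (a i \<le> s)) \<le> (\<Sum>i=1..n. of_bool (b i \<le> s + e) + of_bool (i \<in> ?N) :: real)"
    by (intro sum_mono) auto
  also have "\<dots> = (\<Sum>i=1..n. of_bool (b i \<le> s + e)) + (\<Sum>i=1..n. of_bool (i \<in> ?N))"
    by (rule sum.distrib)
  also have "(\<Sum>i=1..n. of_bool (i \<in> ?N) :: real) = real (card ?N)"
    by (simp add: of_bool_def sum.If_cases Int_def)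
  finally have "(\<Sum>i=1..n. of_bool (a i \<le> s)) \<le> (\<Sum>i=1..n. of_bool (b i \<le> s + e)) + h * real n"
    using few by simp
  then have "1 / real n * (\<Sum>i=1..n. of_bool (a i \<le> s)) \<le>
      1 / real n * ((\<Sum>i=1..n. of_bool (b i \<le> s + e)) + h * real n)"
    by (rule mult_left_mono) simp
  also have "\<dots> = 1 / real n * (\<Sum>i=1..n. of_bool (b i \<le> s + e)) + h"
    using n by (simp only: distrib_left) simp
  finally show ?thesis
    unfolding emp_cdf_def .
qed

text \<open>The score of the new point itself carries weight \<open>1 / (n + 1)\<close> only.\<close>

lemma fc_cdf_emp_cdf_close:
  defines "a \<equiv> \<lambda>C n T z i. C n n (T i) (remove_pt (n + 1) (append_pt n T z) i)"
  shows "\<bar>fc_cdf C n T z s - emp_cdf n (a C n T z) s\<bar> \<le> 1 / (real n + 1)"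
proof (cases "n = 0")
  case False
  define S where "S = (\<Sum>i=1..n. of_bool (a C n T z i \<le> s) :: real)"
  define u where "u = (of_bool (C n n z T \<le> s) :: real)"
  have u: "0 \<le> u" "u \<le> 1" by (auto simp: u_def)
  have "0 \<le> S"
    unfolding S_def by (intro sum_nonneg) auto
  moreover have "S \<le> (\<Sum>i=1..n. 1)"
    unfolding S_def by (intro sum_mono) auto
  ultimately have S: "0 \<le> S / real n" "S / real n \<le> 1"
    using False by auto
  have "fc_cdf C n T z s - emp_cdf n (a C n T z) s =
      1 / (real n + 1) * u + 1 / (real n + 1) * S - 1 / real n * S"
    unfolding fc_cdf_def emp_cdf_def a_def S_def u_def by (simp only: of_nat_add of_nat_1)
  also have "\<dots> = (u - S / real n) / (real n + 1)"
  proof -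
    have "1 / (N + 1) * u + 1 / (N + 1) * S - 1 / N * S = (u - S / N) / (N + 1)" if "0 < N" for N
      using that by (simp add: divide_simps) (simp add: algebra_simps)
    then show ?thesis
      using False by simp
  qed
  finally have "\<bar>fc_cdf C n T z s - emp_cdf n (a C n T z) s\<bar> = \<bar>u - S / real n\<bar> / (real n + 1)"
    by simp
  also have "\<dots> \<le> 1 / (real n + 1)"
    using u S by (intro divide_right_mono) auto
  finally show ?thesis .
qed (auto simp: fc_cdf_def emp_cdf_def)

section \<open>Measurability of scores and prediction sets\<close>

lemma space_Z_space: "space (Z_space S d) = S \<times> space (X_space d)"
  by (simp add: Z_space_def space_pair_measure space_restrict_space)

lemma space_T_space_extensional: "T \<in> space (T_space S d m) \<Longrightarrow> T \<in> extensional {1..m}"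
  by (auto simp: T_space_def space_PiM PiE_def)

lemma measurable_fst_Z_space:
  assumes "f \<in> N \<rightarrow>\<^sub>M Z_space S d"
  shows "(\<lambda>w. fst (f w)) \<in> borel_measurable N"
  using measurable_comp[OF assms[unfolded Z_space_def] measurable_fst]
  by (simp add: comp_def measurable_restrict_space2_iff)

lemma measurable_snd_Z_space:
  assumes "f \<in> N \<rightarrow>\<^sub>M Z_space S d"
  shows "(\<lambda>w. snd (f w)) \<in> N \<rightarrow>\<^sub>M X_space d"
  using measurable_comp[OF assms[unfolded Z_space_def] measurable_snd] by (simp add: comp_def)

lemma measurable_T_space_component:
  assumes "f \<in> N \<rightarrow>\<^sub>M T_space S d m" "i \<in> {1..m}"
  shows "(\<lambda>w. f w i) \<in> N \<rightarrow>\<^sub>M Z_space S d"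
  using measurable_comp[OF assms(1)[unfolded T_space_def] measurable_component_singleton[OF assms(2)]]
  by (simp add: comp_def)

lemma measurable_remove_pt:
  assumes "f \<in> N \<rightarrow>\<^sub>M T_space S d m"
  shows "(\<lambda>w. remove_pt m (f w) i) \<in> N \<rightarrow>\<^sub>M T_space S d (m - 1)"
  unfolding remove_pt_def T_space_def
proof (rule measurable_restrict)
  fix j assume j: "j \<in> {1..m - 1}"
  show "(\<lambda>w. if j < i then f w j else f w (j + 1)) \<in> N \<rightarrow>\<^sub>M Z_space S d"
  proof (cases "j < i")
    case True
    then show ?thesis using measurable_T_space_component[OF assms, of j] j by auto
  next
    case False
    then show ?thesis using measurable_T_space_component[OF assms, of "j + 1"] j by auto
  qed
qed

lemma measurable_append_pt:
  assumes "f \<in> N \<rightarrow>\<^sub>M T_space S d m" "g \<in> N \<rightarrow>\<^sub>M Z_space S d"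
  shows "(\<lambda>w. append_pt m (f w) (g w)) \<in> N \<rightarrow>\<^sub>M T_space S d (m + 1)"
  unfolding append_pt_def T_space_def
  by (rule measurable_fun_upd[where J = "{1..m}"]) (use assms in \<open>auto simp: T_space_def\<close>)

text \<open>Equality of two random features is an event because a feature has finitely many coordinates.\<close>

lemma pred_feature_eq:
  assumes "f \<in> N \<rightarrow>\<^sub>M X_space d" "g \<in> N \<rightarrow>\<^sub>M X_space d"
  shows "Measurable.pred N (\<lambda>w. f w = g w)"
proof -
  have comp: "(\<lambda>w. h w j) \<in> borel_measurable N" if "h \<in> N \<rightarrow>\<^sub>M X_space d" "j \<in> {1..d}" for h j
    using measurable_comp[OF that(1)[unfolded X_space_def] measurable_component_singleton[OF that(2)]]
    by (simp add: comp_def)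
  have ext: "h w \<in> extensional {1..d}" if "h \<in> N \<rightarrow>\<^sub>M X_space d" "w \<in> space N" for h w
    using measurable_space[OF that] by (auto simp: X_space_def space_PiM PiE_def)
  have eq: "f w = g w \<longleftrightarrow> (\<forall>j\<in>{1..d}. f w j = g w j)" if "w \<in> space N" for w
    using ext[OF assms(1) that] ext[OF assms(2) that] by (auto intro: extensionalityI)
  have "Measurable.pred N (\<lambda>w. \<forall>j\<in>{1..d}. f w j = g w j)"
  proof (rule pred_intros_finite)
    fix j assume j: "j \<in> {1..d}"
    note [measurable] = comp[OF assms(1) j] comp[OF assms(2) j]
    show "Measurable.pred N (\<lambda>w. f w j = g w j)"
      by measurable
  qed simp
  then show ?thesis
    using measurable_cong[of N "\<lambda>w. f w = g w" "\<lambda>w. \<forall>j\<in>{1..d}. f w j = g w j"] eq by simp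
qed

text \<open>One fixed sample size. The lower bound 2 guarantees that the leave-one-out predictions are
  trained on at least one point.\<close>

locale prediction_model =
  fixes Y :: "nat \<Rightarrow> real set" and p :: "nat \<Rightarrow> nat" and A :: algorithm and n :: nat
  assumes algorithm_measurable: "\<And>m. 1 \<le> m \<Longrightarrow> (\<lambda>(x, T). A n m x T) \<in>
    X_space (p n) \<Otimes>\<^sub>M T_space (Y n) (p n) m \<rightarrow>\<^sub>M restrict_space borel (Y n)"
    and two_le_n: "2 \<le> n"
begin

abbreviation "XS \<equiv> X_space (p n)"
abbreviation "ZS \<equiv> Z_space (Y n) (p n)"
abbreviation "TS \<equiv> T_space (Y n) (p n)"

lemma measurable_algorithm:
  assumes "1 \<le> m" "f \<in> N \<rightarrow>\<^sub>M XS" "g \<in> N \<rightarrow>\<^sub>M TS m"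
  shows "(\<lambda>w. A n m (f w) (g w)) \<in> borel_measurable N"
  using measurable_compose[OF measurable_Pair[OF assms(2,3)] algorithm_measurable[OF assms(1)]]
  by (simp add: measurable_restrict_space2_iff)

lemma measurable_B_alg:
  assumes "2 \<le> m" and f: "f \<in> N \<rightarrow>\<^sub>M XS" and g: "g \<in> N \<rightarrow>\<^sub>M TS m"
  shows "(\<lambda>w. B_alg A n m (f w) (g w)) \<in> borel_measurable N"
proof -
  have eq [measurable]: "Measurable.pred N (\<lambda>w. snd (g w i) = f w)" if "i \<in> {1..m}" for i
    by (rule pred_feature_eq[OF measurable_snd_Z_space[OF measurable_T_space_component[OF g that]] f])
  have [measurable]: "(\<lambda>w. A n m (f w) (g w)) \<in> borel_measurable N"
    using assms by (intro measurable_algorithm) auto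
  have [measurable]: "(\<lambda>w. A n (m - 1) (f w) (remove_pt m (g w) i)) \<in> borel_measurable N" for i
    using assms by (intro measurable_algorithm measurable_remove_pt) auto
  have sum_eq: "(\<Sum>i\<in>match_set m x T. u i) = (\<Sum>i=1..m. if snd (T i) = x then u i else 0)"
    for x T and u :: "nat \<Rightarrow> real"
    by (simp add: match_set_def sum.If_cases Int_def)
  have card_eq: "real (card (match_set m x T)) = (\<Sum>i=1..m. if snd (T i) = x then 1 else 0)" for x T
    by (simp add: match_set_def sum.If_cases Int_def)
  have nonempty: "match_set m x T \<noteq> {} \<longleftrightarrow> (\<exists>i\<in>{1..m}. snd (T i) = x)" for x T
    by (auto simp: match_set_def)
  show ?thesis
    unfolding B_alg_def sum_eq card_eq nonempty by measurable
qed

lemma measurable_in_sample_score: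
  assumes "1 \<le> m" "f \<in> N \<rightarrow>\<^sub>M ZS" "g \<in> N \<rightarrow>\<^sub>M TS m"
  shows "(\<lambda>w. in_sample_score (B_alg A) n m (f w) (g w)) \<in> borel_measurable N"
proof -
  have [measurable]: "(\<lambda>w. fst (f w)) \<in> borel_measurable N"
    by (rule measurable_fst_Z_space) fact
  have [measurable]: "(\<lambda>w. B_alg A n (m + 1) (snd (f w)) (append_pt m (g w) (f w))) \<in> borel_measurable N"
    using assms by (intro measurable_B_alg measurable_snd_Z_space measurable_append_pt) auto
  show ?thesis
    unfolding in_sample_score_def by measurable
qed

text \<open>Change of the prediction at the \<open>i\<close>-th feature, all other points of the augmented sample
  being used for training, when the new point \<open>z\<close> is dropped from the training set.\<close>

definition swap_diff :: "nat \<Rightarrow> training \<Rightarrow> point \<Rightarrow> real" where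
  "swap_diff i T z = A n n (snd (T i)) (remove_pt (n + 1) (append_pt n T z) i) -
     A n (n - 1) (snd (T i)) (remove_pt n T i)"

lemma measurable_swap_diff:
  assumes "i \<in> {1..n}" "f \<in> N \<rightarrow>\<^sub>M TS n" "g \<in> N \<rightarrow>\<^sub>M ZS"
  shows "(\<lambda>w. swap_diff i (f w) (g w)) \<in> borel_measurable N"
proof -
  have x: "(\<lambda>w. snd (f w i)) \<in> N \<rightarrow>\<^sub>M XS"
    by (rule measurable_snd_Z_space[OF measurable_T_space_component[OF assms(2,1)]])
  have 1: "(\<lambda>w. A n n (snd (f w i)) (remove_pt (n + 1) (append_pt n (f w) (g w)) i)) \<in> borel_measurable N"
    using two_le_n measurable_remove_pt[OF measurable_append_pt[OF assms(2,3)], of i]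
    by (intro measurable_algorithm x) auto
  have 2: "(\<lambda>w. A n (n - 1) (snd (f w i)) (remove_pt n (f w) i)) \<in> borel_measurable N"
    using two_le_n by (intro measurable_algorithm x measurable_remove_pt assms) auto
  show ?thesis
    unfolding swap_diff_def using 1 2 by (rule borel_measurable_diff)
qed

lemma measurable_quantile_condition:
  assumes f: "f \<in> borel_measurable N" and "\<And>w. mono (F w)"
    and F: "\<And>s. (\<lambda>w. F w s) \<in> borel_measurable N"
  shows "Measurable.pred N (\<lambda>w. ereal (f w) \<le> quantile (F w) a + ereal \<delta>)"
  using f borel_measurable_quantile[OF assms(2) F] by measurable

lemma pred_not_jackknife_set:
  "Measurable.pred (TS n \<Otimes>\<^sub>M ZS) (\<lambda>w. fst (snd w) \<notin> jackknife_set Y A n \<alpha> \<delta> (fst w) (snd (snd w)))"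
proof -
  let ?N = "TS n \<Otimes>\<^sub>M ZS"
  have T: "fst \<in> ?N \<rightarrow>\<^sub>M TS n" and z: "snd \<in> ?N \<rightarrow>\<^sub>M ZS"
    by (rule measurable_fst measurable_snd)+
  have [measurable]: "(\<lambda>w. fst (snd w)) \<in> borel_measurable ?N"
    by (rule measurable_fst_Z_space[OF z])
  have [measurable]: "(\<lambda>w. A n n (snd (snd w)) (fst w)) \<in> borel_measurable ?N"
    using two_le_n by (intro measurable_algorithm measurable_snd_Z_space z T) auto
  have [measurable]: "(\<lambda>w. loo_residual A n (fst w) i) \<in> borel_measurable ?N" if i: "i \<in> {1..n}" for i
    unfolding loo_residual_def using two_le_n
    by (intro borel_measurable_diff measurable_algorithm measurable_remove_pt T
        measurable_fst_Z_space[OF measurable_T_space_component[OF T i]]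
        measurable_snd_Z_space[OF measurable_T_space_component[OF T i]]) auto
  have "Measurable.pred ?N (\<lambda>w. ereal \<bar>fst (snd w) - A n n (snd (snd w)) (fst w)\<bar> \<le>
      quantile (emp_cdf n (\<lambda>i. \<bar>loo_residual A n (fst w) i\<bar>)) (1 - \<alpha>) + ereal \<delta>)"
    by (rule measurable_quantile_condition[OF _ emp_cdf_mono]) (unfold emp_cdf_def, measurable)
  then have "Measurable.pred ?N (\<lambda>w. \<not> (ereal \<bar>fst (snd w) - A n n (snd (snd w)) (fst w)\<bar> \<le>
      quantile (emp_cdf n (\<lambda>i. \<bar>loo_residual A n (fst w) i\<bar>)) (1 - \<alpha>) + ereal \<delta>))"
    by measurable
  then show ?thesis
    by (rule measurable_cong[THEN iffD1, rotated])
       (auto simp: jackknife_set_def space_pair_measure space_Z_space)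
qed

lemma pred_not_full_conformal_set:
  "Measurable.pred (TS n \<Otimes>\<^sub>M ZS) (\<lambda>w. fst (snd w) \<notin>
    full_conformal_set Y (in_sample_score (B_alg A)) n \<alpha> \<delta> (fst w) (snd (snd w)))"
proof -
  let ?N = "TS n \<Otimes>\<^sub>M ZS" and ?C = "in_sample_score (B_alg A)"
  have T: "fst \<in> ?N \<rightarrow>\<^sub>M TS n" and z: "snd \<in> ?N \<rightarrow>\<^sub>M ZS"
    by (rule measurable_fst measurable_snd)+
  have [measurable]: "(\<lambda>w. ?C n n (snd w) (fst w)) \<in> borel_measurable ?N"
    using two_le_n by (intro measurable_in_sample_score z T) auto
  have [measurable]: "(\<lambda>w. ?C n n (fst w i) (remove_pt (n + 1) (append_pt n (fst w) (snd w)) i))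
      \<in> borel_measurable ?N" if i: "i \<in> {1..n}" for i
    using two_le_n measurable_remove_pt[OF measurable_append_pt[OF T z], of i]
    by (intro measurable_in_sample_score measurable_T_space_component[OF T i]) auto
  have "Measurable.pred ?N (\<lambda>w. ereal (?C n n (snd w) (fst w)) \<le>
      quantile (fc_cdf ?C n (fst w) (snd w)) (1 - \<alpha>) + ereal \<delta>)"
    by (rule measurable_quantile_condition[OF _ fc_cdf_mono]) (unfold fc_cdf_def, measurable)
  then have "Measurable.pred ?N (\<lambda>w. \<not> (ereal (?C n n (snd w) (fst w)) \<le>
      quantile (fc_cdf ?C n (fst w) (snd w)) (1 - \<alpha>) + ereal \<delta>))"
    by measurable
  then show ?thesis
    by (rule measurable_cong[THEN iffD1, rotated])
       (auto simp: full_conformal_set_def space_pair_measure space_Z_space)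
qed

text \<open>\<open>z\<close> is an atypical new point if dropping it changes too many of the \<open>n\<close> predictions by
  \<open>\<epsilon>\<close> or more.\<close>

definition atypical :: "real \<Rightarrow> real \<Rightarrow> training \<Rightarrow> point \<Rightarrow> bool" where
  "atypical \<epsilon> \<eta> T z \<longleftrightarrow> real (card {i\<in>{1..n}. \<not> \<bar>swap_diff i T z\<bar> < \<epsilon>}) > \<eta> * real n"

lemma card_swap_diff: "real (card {i\<in>{1..n}. \<not> \<bar>swap_diff i T z\<bar> < \<epsilon>}) =
    (\<Sum>i=1..n. if \<not> \<bar>swap_diff i T z\<bar> < \<epsilon> then 1 else 0)"
  by (simp add: sum.If_cases Int_def)

lemma pred_atypical:
  assumes "f \<in> N \<rightarrow>\<^sub>M TS n" "g \<in> N \<rightarrow>\<^sub>M ZS"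
  shows "Measurable.pred N (\<lambda>w. atypical \<epsilon> \<eta> (f w) (g w))"
proof -
  have [measurable]: "(\<lambda>w. swap_diff i (f w) (g w)) \<in> borel_measurable N" if "i \<in> {1..n}" for i
    by (rule measurable_swap_diff[OF that assms])
  show ?thesis
    unfolding atypical_def card_swap_diff by measurable
qed

lemma pred_distinct_features:
  assumes "f \<in> N \<rightarrow>\<^sub>M TS m"
  shows "Measurable.pred N (\<lambda>w. distinct_features m (f w))"
proof -
  have [measurable]: "Measurable.pred N (\<lambda>w. snd (f w i) = snd (f w j))" if "i \<in> {1..m}" "j \<in> {1..m}" for i j
    using pred_feature_eq[OF measurable_snd_Z_space[OF measurable_T_space_component[OF assms that(1)]]
        measurable_snd_Z_space[OF measurable_T_space_component[OF assms that(2)]]] .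
  show ?thesis
    unfolding distinct_features_def inj_on_def by measurable
qed

end

section \<open>Nesting of the jackknife and the full conformal set\<close>

context prediction_model
begin

text \<open>Unless the new point is atypical, the two prediction sets are nested up to a small change
  of level and inflation.\<close>

lemma
  fixes \<epsilon> \<eta> :: real
  defines "h \<equiv> \<eta> + 1 / (real n + 1)"
  assumes T: "T \<in> extensional {1..n}" and dist: "distinct_features (n + 1) (append_pt n T (y, x))"
    and typical: "\<not> atypical \<epsilon> \<eta> T (y, x)"
  shows jackknife_subset_full_conformal:
      "y \<in> jackknife_set Y A n (\<alpha> + h) (\<delta> - \<epsilon>) T x \<Longrightarrow>
       y \<in> full_conformal_set Y (in_sample_score (B_alg A)) n \<alpha> \<delta> T x"
    and full_conformal_subset_jackknife:
      "y \<in> full_conformal_set Y (in_sample_score (B_alg A)) n (\<alpha> + h) (\<delta> - \<epsilon>) T x \<Longrightarrow>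
       y \<in> jackknife_set Y A n \<alpha> \<delta> T x"
proof -
  let ?C = "in_sample_score (B_alg A)"
  define F where "F = fc_cdf ?C n T (y, x)"
  define G where "G = emp_cdf n (\<lambda>i. \<bar>loo_residual A n T i\<bar>)"
  define a where "a i = ?C n n (T i) (remove_pt (n + 1) (append_pt n T (y, x)) i)" for i
  have close: "\<bar>a i - \<bar>loo_residual A n T i\<bar>\<bar> \<le> \<bar>swap_diff i T (y, x)\<bar>" if "i \<in> {1..n}" for i
    using score_swapped_point[OF _ that dist, of A] two_le_n
    unfolding a_def loo_residual_def swap_diff_def by simp
  have "real (card {i\<in>{1..n}. \<not> \<bar>a i - \<bar>loo_residual A n T i\<bar>\<bar> < \<epsilon>})
      \<le> real (card {i\<in>{1..n}. \<not> \<bar>swap_diff i T (y, x)\<bar> < \<epsilon>})"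
    using close by (intro of_nat_mono card_mono) fastforce+
  also have "\<dots> \<le> \<eta> * real n"
    using typical by (simp add: atypical_def)
  finally have few: "real (card {i\<in>{1..n}. \<not> \<bar>a i - \<bar>loo_residual A n T i\<bar>\<bar> < \<epsilon>}) \<le> \<eta> * real n" .
  then have few': "real (card {i\<in>{1..n}. \<not> \<bar>\<bar>loo_residual A n T i\<bar> - a i\<bar> < \<epsilon>}) \<le> \<eta> * real n"
    by (simp add: abs_minus_commute)
  have FE: "\<bar>F s - emp_cdf n a s\<bar> \<le> 1 / (real n + 1)" for s
    unfolding F_def a_def by (rule fc_cdf_emp_cdf_close)
  have FG: "F s \<le> G (s + \<epsilon>) + h" for s
    using FE[of s] emp_cdf_close[OF _ few, of s] two_le_n unfolding G_def h_def by linarith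
  have GF: "G s \<le> F (s + \<epsilon>) + h" for s
    using FE[of "s + \<epsilon>"] emp_cdf_close[OF _ few', of s] two_le_n unfolding G_def h_def by linarith
  have s0: "?C n n (y, x) T = \<bar>y - A n n x T\<bar>"
    using score_new_point[OF _ T dist, of A] two_le_n by simp
  have shift: "c \<le> v + ereal \<delta>" if "c \<le> u + ereal (\<delta> - \<epsilon>)" "u \<le> v + ereal \<epsilon>" for c u v :: ereal
  proof -
    have "c \<le> (v + ereal \<epsilon>) + ereal (\<delta> - \<epsilon>)"
      using that by (meson add_right_mono order_trans)
    then show ?thesis by (cases v) auto
  qed
  show "y \<in> full_conformal_set Y ?C n \<alpha> \<delta> T x" if "y \<in> jackknife_set Y A n (\<alpha> + h) (\<delta> - \<epsilon>) T x"
    using that shift[OF _ quantile_shift_le[of F G \<epsilon> h "1 - \<alpha>", OF FG], of "ereal \<bar>y - A n n x T\<bar>"]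
    unfolding jackknife_set_def full_conformal_set_def mem_Collect_eq s0
    by (simp add: F_def G_def algebra_simps)
  show "y \<in> jackknife_set Y A n \<alpha> \<delta> T x" if "y \<in> full_conformal_set Y ?C n (\<alpha> + h) (\<delta> - \<epsilon>) T x"
    using that shift[OF _ quantile_shift_le[of G F \<epsilon> h "1 - \<alpha>", OF GF], of "ereal \<bar>y - A n n x T\<bar>"]
    unfolding jackknife_set_def full_conformal_set_def mem_Collect_eq s0
    by (simp add: F_def G_def algebra_simps)
qed

end

section \<open>The law of the sample and the new point\<close>

lemma sets_X_space_singleton:
  assumes "x \<in> space (X_space d)"
  shows "{x} \<in> sets (X_space d)"
proof -
  have "Measurable.pred (X_space d) (\<lambda>x'. x' = x)"
    using assms by (rule pred_feature_eq[OF measurable_ident_sets[OF refl] measurable_const])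
  moreover have "{x' \<in> space (X_space d). x' = x} = {x}"
    using assms by auto
  ultimately show ?thesis
    unfolding pred_def by simp
qed

lemma nonatomic_singleton_null:
  assumes "nonatomic \<mu>" "{x} \<in> sets \<mu>"
  shows "emeasure \<mu> {x} = 0"
proof (rule ccontr)
  assume "emeasure \<mu> {x} \<noteq> 0"
  then have "emeasure \<mu> {x} > 0" by (simp add: zero_less_iff_neq_zero)
  then obtain B where "B \<subseteq> {x}" "0 < emeasure \<mu> B" "emeasure \<mu> B < emeasure \<mu> {x}"
    using assms unfolding nonatomic_def by blast
  then show False
    by (cases "x \<in> B") (auto simp: subset_singleton_iff)
qed

lemma append_pt_sample:
  "append_pt n (sample t n \<omega>) (t n (n + 1) \<omega>) = (\<lambda>i\<in>{1..n + 1}. t n i \<omega>)"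
  by (auto simp: append_pt_def sample_def restrict_def fun_eq_iff)

text \<open>The data for one sample size; \<open>\<kappa> n T\<close> is the distribution of the new point given the sample \<open>T\<close>.\<close>

locale iid_model = prediction_model Y p A n + prob_space M
  for Y p A n and M :: "'w measure" +
  fixes P :: "point measure" and t :: "nat \<Rightarrow> nat \<Rightarrow> 'w \<Rightarrow> point"
    and \<kappa> :: "nat \<Rightarrow> training \<Rightarrow> point measure"
  assumes P_prob: "prob_space P" and P_sets: "sets P = sets ZS"
    and indep: "indep_vars (\<lambda>_. ZS) (t n) {1..n + 1}"
    and ident: "\<And>i. i \<in> {1..n + 1} \<Longrightarrow> distr M ZS (t n i) = P"
    and cond: "regular_cond_distr M (TS n) (sample t n) ZS (t n (n + 1)) (\<kappa> n)"
    and nonatomic: "nonatomic (distr P XS snd)"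
begin

lemma point_measurable: "i \<in> {1..n + 1} \<Longrightarrow> t n i \<in> M \<rightarrow>\<^sub>M ZS"
  using indep by (auto simp: indep_vars_def)

lemma new_point_measurable [measurable]: "t n (n + 1) \<in> M \<rightarrow>\<^sub>M ZS"
  by (rule point_measurable) simp

lemma sample_measurable [measurable]: "sample t n \<in> M \<rightarrow>\<^sub>M TS n"
  unfolding sample_def T_space_def by (rule measurable_restrict) (simp add: point_measurable)

lemma kernel_measurable [measurable]: "\<kappa> n \<in> TS n \<rightarrow>\<^sub>M prob_algebra ZS"
  using cond by (simp add: regular_cond_distr_def)

lemma sample_new_point_measurable:
  "(\<lambda>\<omega>. (sample t n \<omega>, t n (n + 1) \<omega>)) \<in> M \<rightarrow>\<^sub>M TS n \<Otimes>\<^sub>M ZS"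
  by (intro measurable_Pair sample_measurable new_point_measurable)

lemma sample_space: "\<omega> \<in> space M \<Longrightarrow> sample t n \<omega> \<in> space (TS n)"
  using measurable_space[OF sample_measurable] .

lemma kernel_prob:
  assumes "T \<in> space (TS n)"
  shows "prob_space (\<kappa> n T)" "sets (\<kappa> n T) = sets ZS" "space (\<kappa> n T) = space ZS"
proof -
  show "prob_space (\<kappa> n T)" and *: "sets (\<kappa> n T) = sets ZS"
    using measurable_space[OF kernel_measurable assms] by (auto simp: space_prob_algebra)
  show "space (\<kappa> n T) = space ZS"
    using sets_eq_imp_space_eq[OF *] .
qed

lemma pair_law:
  assumes "i \<in> {1..n + 1}" "j \<in> {1..n + 1}" "i \<noteq> j"
  shows "distr M (ZS \<Otimes>\<^sub>M ZS) (\<lambda>\<omega>. (t n i \<omega>, t n j \<omega>)) = P \<Otimes>\<^sub>M P"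
proof -
  have "indep_var (PiM {i} (\<lambda>_. ZS)) (\<lambda>\<omega>. restrict (\<lambda>i. t n i \<omega>) {i})
      (PiM {j} (\<lambda>_. ZS)) (\<lambda>\<omega>. restrict (\<lambda>i. t n i \<omega>) {j})"
    by (rule indep_var_restrict[OF indep]) (use assms in auto)
  then have "indep_var ZS ((\<lambda>f. f i) \<circ> (\<lambda>\<omega>. restrict (\<lambda>i. t n i \<omega>) {i}))
      ZS ((\<lambda>f. f j) \<circ> (\<lambda>\<omega>. restrict (\<lambda>i. t n i \<omega>) {j}))"
    by (rule indep_var_compose) (auto intro: measurable_component_singleton)
  then have "indep_var ZS (t n i) ZS (t n j)"
    by (simp add: comp_def)
  then show ?thesis
    using ident[OF assms(1)] ident[OF assms(2)] by (simp add: indep_var_distribution_eq)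
qed

lemma AE_feature_neq:
  assumes "x \<in> space XS"
  shows "AE z in P. x \<noteq> snd z"
proof -
  have meas: "snd \<in> P \<rightarrow>\<^sub>M XS"
    using measurable_snd_Z_space[OF measurable_ident, of "Y n" "p n"]
    by (simp add: measurable_cong_sets[OF P_sets refl])
  have "emeasure (distr P XS snd) {x} = 0"
    using sets_X_space_singleton[OF assms] by (intro nonatomic_singleton_null nonatomic) simp
  then have "emeasure P {z \<in> space P. \<not> x \<noteq> snd z} = 0"
    using sets_X_space_singleton[OF assms] meas
    by (simp add: emeasure_distr vimage_def Int_def conj_commute eq_commute[of x])
  moreover have "{z \<in> space P. \<not> x \<noteq> snd z} = snd -` {x} \<inter> space P"
    by auto
  ultimately show ?thesis
    using measurable_sets[OF meas sets_X_space_singleton[OF assms]] by (intro AE_I[where N = "snd -` {x} \<inter> space P"]) auto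
qed

lemma AE_features_neq:
  assumes "i \<in> {1..n + 1}" "j \<in> {1..n + 1}" "i \<noteq> j"
  shows "AE \<omega> in M. snd (t n i \<omega>) \<noteq> snd (t n j \<omega>)"
proof -
  interpret P: prob_space P by (rule P_prob)
  interpret PP: pair_sigma_finite P P ..
  have sets_eq: "sets (P \<Otimes>\<^sub>M P) = sets (ZS \<Otimes>\<^sub>M ZS)"
    by (intro sets_pair_measure_cong P_sets)
  have meas: "(\<lambda>\<omega>. (t n i \<omega>, t n j \<omega>)) \<in> M \<rightarrow>\<^sub>M ZS \<Otimes>\<^sub>M ZS"
    by (intro measurable_Pair point_measurable assms)
  have "Measurable.pred (ZS \<Otimes>\<^sub>M ZS) (\<lambda>w. snd (fst w) = snd (snd w))"
    by (intro pred_feature_eq[of _ _ "p n"] measurable_snd_Z_space[of _ _ "Y n"] measurable_fst measurable_snd)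
  then have pred: "{w \<in> space (ZS \<Otimes>\<^sub>M ZS). snd (fst w) \<noteq> snd (snd w)} \<in> sets (ZS \<Otimes>\<^sub>M ZS)"
    by measurable
  have "AE w in P \<Otimes>\<^sub>M P. snd (fst w) \<noteq> snd (snd w)"
  proof (rule PP.AE_pair_measure)
    show "{w \<in> space (P \<Otimes>\<^sub>M P). snd (fst w) \<noteq> snd (snd w)} \<in> sets (P \<Otimes>\<^sub>M P)"
      unfolding sets_eq sets_eq_imp_space_eq[OF sets_eq] by (rule pred)
    show "AE z in P. AE z' in P. snd (fst (z, z')) \<noteq> snd (snd (z, z'))"
    proof (rule AE_I2)
      fix z assume "z \<in> space P"
      then have "snd z \<in> space XS"
        unfolding sets_eq_imp_space_eq[OF P_sets] space_Z_space by (simp add: mem_Times_iff)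
      then show "AE z' in P. snd (fst (z, z')) \<noteq> snd (snd (z, z'))"
        unfolding fst_conv snd_conv by (rule AE_feature_neq)
    qed
  qed
  then have "AE w in distr M (ZS \<Otimes>\<^sub>M ZS) (\<lambda>\<omega>. (t n i \<omega>, t n j \<omega>)). snd (fst w) \<noteq> snd (snd w)"
    unfolding pair_law[OF assms] .
  then show ?thesis
    using AE_distrD[OF meas] by fastforce
qed

lemma AE_distinct_features:
  "AE \<omega> in M. distinct_features (n + 1) (append_pt n (sample t n \<omega>) (t n (n + 1) \<omega>))"
proof -
  have "AE \<omega> in M. \<forall>i\<in>{1..n + 1}. \<forall>j\<in>{1..n + 1}. i \<noteq> j \<longrightarrow> snd (t n i \<omega>) \<noteq> snd (t n j \<omega>)"
    using AE_features_neq by (intro AE_finite_allI) auto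
  then show ?thesis
    unfolding append_pt_sample distinct_features_def inj_on_def
    by eventually_elim (metis restrict_apply')
qed

text \<open>The kernel disintegrates the joint law of the sample and the new point. Both sides are
  measures on the product space, so it is enough to compare them on rectangles, where the identity
  is the defining property of the conditional expectation.\<close>

lemma joint_law:
  "distr M (TS n \<Otimes>\<^sub>M ZS) (\<lambda>\<omega>. (sample t n \<omega>, t n (n + 1) \<omega>)) =
   M \<bind> (\<lambda>\<omega>. distr (\<kappa> n (sample t n \<omega>)) (TS n \<Otimes>\<^sub>M ZS) (\<lambda>z. (sample t n \<omega>, z)))"
  (is "?N1 = ?N2")
proof -
  let ?S = "TS n" and ?T = "sample t n" and ?V = "t n (n + 1)"
  let ?F = "vimage_algebra (space M) ?T ?S"
  have ker: "(\<lambda>\<omega>. \<kappa> n (?T \<omega>)) \<in> M \<rightarrow>\<^sub>M subprob_algebra ZS"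
    by (intro measurable_prob_algebraD) measurable
  have bindker: "(\<lambda>\<omega>. distr (\<kappa> n (?T \<omega>)) (?S \<Otimes>\<^sub>M ZS) (\<lambda>z. (?T \<omega>, z))) \<in> M \<rightarrow>\<^sub>M subprob_algebra (?S \<Otimes>\<^sub>M ZS)"
    by (rule measurable_distr2[OF _ ker]) measurable
  have sub: "subalgebra M ?F"
    unfolding subalgebra_def using sets_image_in_sets[OF refl sample_measurable] by simp
  interpret F: finite_measure_subalgebra M ?F
    by standard (rule sub)
  have rect: "emeasure ?N1 (a \<times> b) = emeasure ?N2 (a \<times> b)" if a: "a \<in> sets ?S" and b: "b \<in> sets ZS" for a b
  proof -
    let ?a = "?T -` a \<inter> space M" and ?b = "?V -` b \<inter> space M"
    have aF: "?a \<in> sets ?F" by (rule in_vimage_algebra[OF a])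
    have aM: "?a \<in> sets M" and bM: "?b \<in> sets M"
      using a b by measurable
    have ab: "a \<times> b \<in> sets (?S \<Otimes>\<^sub>M ZS)"
      using a b by (rule pair_measureI)
    have kb [measurable]: "(\<lambda>\<omega>. measure (\<kappa> n (?T \<omega>)) b) \<in> borel_measurable M"
      using measurable_compose[OF ker measurable_measure_subprob_algebra[OF b]] .
    have "emeasure ?N1 (a \<times> b) = emeasure M (?a \<inter> ?b)"
      by (subst emeasure_distr[OF sample_new_point_measurable ab]) (auto intro!: arg_cong[where f = "emeasure M"])
    also have "\<dots> = ennreal (measure M (?a \<inter> ?b))"
      by (simp add: emeasure_eq_measure)
    also have "measure M (?a \<inter> ?b) = (\<integral>\<omega>\<in>?a. indicator ?b \<omega> \<partial>M)"
      using aM bM by (simp add: set_lebesgue_integral_def indicator_inter_arith[symmetric])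
    also have "\<dots> = (\<integral>\<omega>\<in>?a. real_cond_exp M ?F (indicator ?b) \<omega> \<partial>M)"
      using bM by (intro F.real_cond_exp_intA aF) (simp add: emeasure_eq_measure)
    also have "\<dots> = (\<integral>\<omega>. indicator ?a \<omega> * measure (\<kappa> n (?T \<omega>)) b \<partial>M)"
    proof -
      have "AE \<omega> in M. measure (\<kappa> n (?T \<omega>)) b = real_cond_exp M ?F (indicator ?b) \<omega>"
        using cond b unfolding regular_cond_distr_def by blast
      then have "AE \<omega> in M. indicator ?a \<omega> *\<^sub>R real_cond_exp M ?F (indicator ?b) \<omega> =
          indicator ?a \<omega> * measure (\<kappa> n (?T \<omega>)) b"
        by eventually_elim simp
      then show ?thesis
        unfolding set_lebesgue_integral_def
        by (intro integral_cong_AE borel_measurable_scaleR borel_measurable_times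
            borel_measurable_indicator aM borel_measurable_cond_exp2 kb)
    qed
    also have "ennreal \<dots> = (\<integral>\<^sup>+\<omega>. ennreal (indicator ?a \<omega> * measure (\<kappa> n (?T \<omega>)) b) \<partial>M)"
    proof (rule nn_integral_eq_integral[symmetric])
      have "AE \<omega> in M. norm (indicator ?a \<omega> * measure (\<kappa> n (?T \<omega>)) b) \<le> 1"
        using kernel_prob(1)[OF sample_space] by (intro AE_I2) (auto simp: indicator_def prob_space.prob_le_1)
      then show "integrable M (\<lambda>\<omega>. indicator ?a \<omega> * measure (\<kappa> n (?T \<omega>)) b)"
        using aM by (intro integrable_const_bound[where B = 1]) auto
    qed auto
    also have "\<dots> = (\<integral>\<^sup>+\<omega>. emeasure (distr (\<kappa> n (?T \<omega>)) (?S \<Otimes>\<^sub>M ZS) (\<lambda>z. (?T \<omega>, z))) (a \<times> b) \<partial>M)"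
    proof (rule nn_integral_cong)
      fix \<omega> assume w: "\<omega> \<in> space M"
      interpret K: prob_space "\<kappa> n (?T \<omega>)"
        by (rule kernel_prob(1)[OF sample_space[OF w]])
      have Kb: "b \<in> sets (\<kappa> n (?T \<omega>))"
        using b kernel_prob(2)[OF sample_space[OF w]] by simp
      have "(\<lambda>z. (?T \<omega>, z)) \<in> \<kappa> n (?T \<omega>) \<rightarrow>\<^sub>M ?S \<Otimes>\<^sub>M ZS"
        unfolding measurable_cong_sets[OF kernel_prob(2)[OF sample_space[OF w]] refl]
        using sample_space[OF w] by measurable
      moreover have "(\<lambda>z. (?T \<omega>, z)) -` (a \<times> b) \<inter> space (\<kappa> n (?T \<omega>)) = (if ?T \<omega> \<in> a then b else {})"
        using sets.sets_into_space[OF Kb] by auto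
      ultimately have "emeasure (distr (\<kappa> n (?T \<omega>)) (?S \<Otimes>\<^sub>M ZS) (\<lambda>z. (?T \<omega>, z))) (a \<times> b) =
          emeasure (\<kappa> n (?T \<omega>)) (if ?T \<omega> \<in> a then b else {})"
        using ab by (simp add: emeasure_distr)
      then show "ennreal (indicator ?a \<omega> * measure (\<kappa> n (?T \<omega>)) b) =
          emeasure (distr (\<kappa> n (?T \<omega>)) (?S \<Otimes>\<^sub>M ZS) (\<lambda>z. (?T \<omega>, z))) (a \<times> b)"
        using w by (auto simp: K.emeasure_eq_measure indicator_def)
    qed
    also have "\<dots> = emeasure ?N2 (a \<times> b)"
      using ab by (rule emeasure_bind[OF not_empty bindker, symmetric])
    finally show ?thesis .
  qed
  let ?E = "{a \<times> b | a b. a \<in> sets ?S \<and> b \<in> sets ZS}"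
  show ?thesis
  proof (rule measure_eqI_generator_eq[OF Int_stable_pair_measure_generator pair_measure_closed,
        where A = "\<lambda>_. space ?S \<times> space ZS"])
    show "emeasure ?N1 X = emeasure ?N2 X" if "X \<in> ?E" for X
      using that rect by auto
    show "sets ?N1 = sigma_sets (space ?S \<times> space ZS) ?E"
      by (simp add: sets_pair_measure)
    show "sets ?N2 = sigma_sets (space ?S \<times> space ZS) ?E"
      using sets_bind[OF sets_kernel[OF bindker] not_empty] by (simp add: sets_pair_measure)
    show "range (\<lambda>_. space ?S \<times> space ZS) \<subseteq> ?E"
      by auto
    show "emeasure ?N1 (space ?S \<times> space ZS) \<noteq> \<infinity>" for i
      using measurable_space[OF sample_measurable]
      by (subst emeasure_distr[OF sample_new_point_measurable]) (auto simp: emeasure_eq_measure)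
  qed auto
qed

lemma kernel_measure_measurable:
  assumes "Measurable.pred (TS n \<Otimes>\<^sub>M ZS) (\<lambda>w. Q (fst w) (snd w))"
  shows "(\<lambda>\<omega>. measure (\<kappa> n (sample t n \<omega>)) {z \<in> space ZS. Q (sample t n \<omega>) z}) \<in> borel_measurable M"
proof -
  have "Sigma (space (TS n)) (\<lambda>T. {z \<in> space ZS. Q T z}) =
      {w \<in> space (TS n \<Otimes>\<^sub>M ZS). Q (fst w) (snd w)}"
    by (auto simp: space_pair_measure)
  then have "(\<lambda>T. measure (\<kappa> n T) {z \<in> space ZS. Q T z}) \<in> borel_measurable (TS n)"
    using assms by (intro measure_measurable_prob_algebra2[OF _ kernel_measurable]) (simp add: pred_def)
  then show ?thesis
    by (rule measurable_compose[OF sample_measurable])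
qed

lemma kernel_measure_bound: "\<omega> \<in> space M \<Longrightarrow> measure (\<kappa> n (sample t n \<omega>)) B \<le> 1"
  using kernel_prob(1)[OF sample_space] by (simp add: prob_space.prob_le_1)

lemma kernel_measure_integrable:
  assumes "Measurable.pred (TS n \<Otimes>\<^sub>M ZS) (\<lambda>w. Q (fst w) (snd w))"
  shows "integrable M (\<lambda>\<omega>. measure (\<kappa> n (sample t n \<omega>)) {z \<in> space ZS. Q (sample t n \<omega>) z})"
  by (rule integrable_const_bound[where B = 1])
     (auto intro!: AE_I2 kernel_measure_bound kernel_measure_measurable assms)

lemma integral_kernel_measure:
  assumes Q: "Measurable.pred (TS n \<Otimes>\<^sub>M ZS) (\<lambda>w. Q (fst w) (snd w))"
  shows "(\<integral>\<omega>. measure (\<kappa> n (sample t n \<omega>)) {z \<in> space ZS. Q (sample t n \<omega>) z} \<partial>M) =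
    prob {\<omega> \<in> space M. Q (sample t n \<omega>) (t n (n + 1) \<omega>)}"
proof -
  let ?E = "{w \<in> space (TS n \<Otimes>\<^sub>M ZS). Q (fst w) (snd w)}"
  have E: "?E \<in> sets (TS n \<Otimes>\<^sub>M ZS)"
    using Q by (simp add: pred_def)
  have ker: "(\<lambda>\<omega>. \<kappa> n (sample t n \<omega>)) \<in> M \<rightarrow>\<^sub>M subprob_algebra ZS"
    by (intro measurable_prob_algebraD) measurable
  have bindker: "(\<lambda>\<omega>. distr (\<kappa> n (sample t n \<omega>)) (TS n \<Otimes>\<^sub>M ZS) (\<lambda>z. (sample t n \<omega>, z)))
      \<in> M \<rightarrow>\<^sub>M subprob_algebra (TS n \<Otimes>\<^sub>M ZS)"
    by (rule measurable_distr2[OF _ ker]) measurable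
  have "ennreal (prob {\<omega> \<in> space M. Q (sample t n \<omega>) (t n (n + 1) \<omega>)}) =
      emeasure (distr M (TS n \<Otimes>\<^sub>M ZS) (\<lambda>\<omega>. (sample t n \<omega>, t n (n + 1) \<omega>))) ?E"
    using E measurable_space[OF sample_measurable] measurable_space[OF new_point_measurable]
    by (subst emeasure_distr[OF sample_new_point_measurable E])
       (auto simp: emeasure_eq_measure space_pair_measure intro!: arg_cong[where f = prob])
  also have "\<dots> = (\<integral>\<^sup>+\<omega>. emeasure (distr (\<kappa> n (sample t n \<omega>)) (TS n \<Otimes>\<^sub>M ZS) (\<lambda>z. (sample t n \<omega>, z))) ?E \<partial>M)"
    unfolding joint_law by (rule emeasure_bind[OF not_empty bindker E])
  also have "\<dots> = (\<integral>\<^sup>+\<omega>. ennreal (measure (\<kappa> n (sample t n \<omega>)) {z \<in> space ZS. Q (sample t n \<omega>) z}) \<partial>M)"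
  proof (rule nn_integral_cong)
    fix \<omega> assume w: "\<omega> \<in> space M"
    interpret K: prob_space "\<kappa> n (sample t n \<omega>)"
      by (rule kernel_prob(1)[OF sample_space[OF w]])
    have "(\<lambda>z. (sample t n \<omega>, z)) \<in> \<kappa> n (sample t n \<omega>) \<rightarrow>\<^sub>M TS n \<Otimes>\<^sub>M ZS"
      unfolding measurable_cong_sets[OF kernel_prob(2)[OF sample_space[OF w]] refl]
      using sample_space[OF w] by measurable
    moreover have "(\<lambda>z. (sample t n \<omega>, z)) -` ?E \<inter> space (\<kappa> n (sample t n \<omega>)) =
        {z \<in> space ZS. Q (sample t n \<omega>) z}"
      using sample_space[OF w] kernel_prob(3)[OF sample_space[OF w]] by (auto simp: space_pair_measure)
    ultimately show "emeasure (distr (\<kappa> n (sample t n \<omega>)) (TS n \<Otimes>\<^sub>M ZS) (\<lambda>z. (sample t n \<omega>, z))) ?E =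
        ennreal (measure (\<kappa> n (sample t n \<omega>)) {z \<in> space ZS. Q (sample t n \<omega>) z})"
      using E by (simp add: emeasure_distr K.emeasure_eq_measure)
  qed
  also have "\<dots> = ennreal (\<integral>\<omega>. measure (\<kappa> n (sample t n \<omega>)) {z \<in> space ZS. Q (sample t n \<omega>) z} \<partial>M)"
    by (rule nn_integral_eq_integral[OF kernel_measure_integrable[OF Q]]) simp
  finally show ?thesis
    by (simp add: integral_nonneg_AE)
qed

text \<open>The features are almost surely distinct, hence, conditionally on almost every sample, distinct for
  almost every new point.\<close>

lemma AE_kernel_distinct_features:
  "AE \<omega> in M. AE z in \<kappa> n (sample t n \<omega>). distinct_features (n + 1) (append_pt n (sample t n \<omega>) z)"
proof -
  let ?Q = "\<lambda>T z. \<not> distinct_features (n + 1) (append_pt n T z)"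
  have "Measurable.pred (TS n \<Otimes>\<^sub>M ZS) (\<lambda>w. distinct_features (n + 1) (append_pt n (fst w) (snd w)))"
    by (intro pred_distinct_features[where N = "TS n \<Otimes>\<^sub>M ZS"] measurable_append_pt measurable_fst measurable_snd)
  then have Q: "Measurable.pred (TS n \<Otimes>\<^sub>M ZS) (\<lambda>w. ?Q (fst w) (snd w))"
    by measurable
  have "prob {\<omega> \<in> space M. ?Q (sample t n \<omega>) (t n (n + 1) \<omega>)} = 0"
    by (rule prob_eq_0_AE) (use AE_distinct_features in simp)
  then have "(\<integral>\<omega>. measure (\<kappa> n (sample t n \<omega>)) {z \<in> space ZS. ?Q (sample t n \<omega>) z} \<partial>M) = 0"
    unfolding integral_kernel_measure[OF Q] .
  then have "AE \<omega> in M. measure (\<kappa> n (sample t n \<omega>)) {z \<in> space ZS. ?Q (sample t n \<omega>) z} = 0"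
    by (subst (asm) integral_nonneg_eq_0_iff_AE[OF kernel_measure_integrable[OF Q]]) auto
  then show ?thesis
    using AE_space
  proof eventually_elim
    case (elim \<omega>)
    interpret K: prob_space "\<kappa> n (sample t n \<omega>)"
      by (rule kernel_prob(1)[OF sample_space[OF elim(2)]])
    have sp: "sample t n \<omega> \<in> space (TS n)" by (rule sample_space[OF elim(2)])
    have "Measurable.pred ZS (\<lambda>z. ?Q (sample t n \<omega>) z)"
      using measurable_compose[OF measurable_Pair1'[OF sp] Q] by simp
    then have "{z \<in> space ZS. ?Q (sample t n \<omega>) z} \<in> sets (\<kappa> n (sample t n \<omega>))"
      using kernel_prob(2)[OF sp] by (simp add: pred_def)
    then show ?case
      using elim(1) kernel_prob(3)[OF sp]
      by (intro AE_I[where N = "{z \<in> space ZS. ?Q (sample t n \<omega>) z}"]) (auto simp: K.emeasure_eq_measure)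
  qed
qed

end

section \<open>Exchangeability and atypical points\<close>

context iid_model
begin

text \<open>The change of prediction that out-of-sample stability controls.\<close>

definition stability_diff :: "'w \<Rightarrow> real" where
  "stability_diff \<omega> =
     A n n (snd (t n (n + 1) \<omega>)) (sample t n \<omega>) -
     A n (n - 1) (snd (t n (n + 1) \<omega>)) (remove_pt n (sample t n \<omega>) n)"

lemma stability_diff_measurable: "stability_diff \<in> borel_measurable M"
proof -
  have x: "(\<lambda>\<omega>. snd (t n (n + 1) \<omega>)) \<in> M \<rightarrow>\<^sub>M XS"
    by (rule measurable_snd_Z_space[OF new_point_measurable])
  show ?thesis
    unfolding stability_diff_def[abs_def] using two_le_n
    by (intro borel_measurable_diff measurable_algorithm x measurable_remove_pt sample_measurable) auto
qed

text \<open>By exchangeability every change of a prediction caused by the new point is distributed as the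
  one controlled by stability: the cyclic permutation that moves the \<open>i\<close>-th point to the end
  turns one into the other, training sets included, since it keeps the order of the other points.\<close>

lemma swap_diff_law:
  assumes i: "i \<in> {1..n}"
  shows "prob {\<omega> \<in> space M. \<not> \<bar>swap_diff i (sample t n \<omega>) (t n (n + 1) \<omega>)\<bar> < \<epsilon>} =
    prob {\<omega> \<in> space M. \<not> \<bar>stability_diff \<omega>\<bar> < \<epsilon>}"
proof -
  let ?I = "{1..n + 1}"
  define D where "D \<omega> = (\<lambda>j\<in>?I. t n j \<omega>)" for \<omega>
  \<comment> \<open>moves entry \<open>i\<close> to position \<open>n + 1\<close> and closes the gap\<close>
  define \<sigma> where "\<sigma> k = (if k < i then k else if k \<le> n then k + 1 else i)" for k
  define rot where "rot W = (\<lambda>k\<in>?I. W (\<sigma> k))" for W :: training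
  define H where "H W = A n n (snd (W (n + 1))) (restrict W {1..n}) -
    A n (n - 1) (snd (W (n + 1))) (restrict W {1..n - 1})" for W :: training
  define L where "L = PiM ?I (\<lambda>_. P)"
  have sets_L: "sets L = sets (TS (n + 1))"
    unfolding L_def T_space_def by (intro sets_PiM_cong refl P_sets)
  have \<sigma>_into: "\<sigma> \<in> ?I \<rightarrow> ?I"
    using i by (auto simp: \<sigma>_def)
  have \<sigma>_inj: "inj_on \<sigma> ?I"
    using i by (auto simp: inj_on_def \<sigma>_def split: if_splits)
  have law: "distr M (TS (n + 1)) D = L"
  proof -
    have "distr M (TS (n + 1)) D = PiM ?I (\<lambda>j. distr M ZS (t n j))"
      using indep_vars_iff_distr_eq_PiM'[of ?I "t n" "\<lambda>_. ZS"] indep point_measurable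
      unfolding D_def[abs_def] T_space_def by simp
    also have "\<dots> = L"
      unfolding L_def by (intro PiM_cong refl ident)
    finally show ?thesis .
  qed
  have D: "D \<in> M \<rightarrow>\<^sub>M TS (n + 1)"
    unfolding D_def[abs_def] T_space_def by (intro measurable_restrict point_measurable)
  have rot: "distr L L rot = L"
    using distr_PiM_reindex[OF P_prob \<sigma>_inj \<sigma>_into] unfolding L_def rot_def[abs_def] .
  have rot_meas: "rot \<in> L \<rightarrow>\<^sub>M L"
    unfolding L_def rot_def[abs_def] using \<sigma>_into
    by (intro measurable_restrict measurable_component_singleton) auto
  have H: "H \<in> borel_measurable (TS (n + 1))"
  proof -
    have x: "(\<lambda>W. snd (W (n + 1))) \<in> TS (n + 1) \<rightarrow>\<^sub>M XS"
      by (rule measurable_snd_Z_space[OF measurable_T_space_component[OF measurable_ident_sets[OF refl]]]) simp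
    have r: "(\<lambda>W. restrict W {1..m}) \<in> TS (n + 1) \<rightarrow>\<^sub>M TS m" if "m \<le> n" for m
      unfolding T_space_def using that by (intro measurable_restrict_subset) auto
    show ?thesis
      unfolding H_def[abs_def] using two_le_n
      by (intro borel_measurable_diff measurable_algorithm x r) auto
  qed
  define S where "S = {W \<in> space (TS (n + 1)). \<not> \<bar>H W\<bar> < \<epsilon>}"
  have S: "S \<in> sets (TS (n + 1))"
    unfolding S_def using H by measurable
  have prob_D: "measure L B = prob (D -` B \<inter> space M)" if "B \<in> sets (TS (n + 1))" for B
    using measure_distr[OF D that] unfolding law .
  have H_D: "H (D \<omega>) = stability_diff \<omega>" for \<omega>
  proof -
    have "restrict (D \<omega>) {1..n} = sample t n \<omega>"
      by (auto simp: D_def sample_def restrict_def fun_eq_iff)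
    moreover have "restrict (D \<omega>) {1..n - 1} = remove_pt n (sample t n \<omega>) n"
      by (auto simp: D_def sample_def remove_pt_def restrict_def fun_eq_iff)
    ultimately show ?thesis
      unfolding H_def stability_diff_def by (simp add: D_def)
  qed
  have H_rot: "H (rot (D \<omega>)) = swap_diff i (sample t n \<omega>) (t n (n + 1) \<omega>)" for \<omega>
  proof -
    have "restrict (rot (D \<omega>)) {1..n} = remove_pt (n + 1) (append_pt n (sample t n \<omega>) (t n (n + 1) \<omega>)) i"
      unfolding append_pt_sample using i
      by (auto simp: rot_def D_def remove_pt_def restrict_def fun_eq_iff \<sigma>_def)
    moreover have "restrict (rot (D \<omega>)) {1..n - 1} = remove_pt n (sample t n \<omega>) i"
      using i by (auto simp: rot_def D_def sample_def remove_pt_def restrict_def fun_eq_iff \<sigma>_def)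
    moreover have "rot (D \<omega>) (n + 1) = sample t n \<omega> i"
      using i by (simp add: rot_def D_def sample_def \<sigma>_def)
    ultimately show ?thesis
      unfolding H_def swap_diff_def by simp
  qed
  have "prob {\<omega> \<in> space M. \<not> \<bar>stability_diff \<omega>\<bar> < \<epsilon>} = prob (D -` S \<inter> space M)"
    using measurable_space[OF D] by (intro arg_cong[where f = prob]) (auto simp: S_def H_D)
  also have "\<dots> = measure (distr L L rot) S"
    unfolding rot using prob_D[OF S] by simp
  also have "\<dots> = measure L (rot -` S \<inter> space L)"
    using S sets_L by (intro measure_distr rot_meas) simp
  also have "\<dots> = prob (D -` (rot -` S \<inter> space L) \<inter> space M)"
    using measurable_sets[OF rot_meas, of S] S sets_L by (intro prob_D) simp
  also have "\<dots> = prob {\<omega> \<in> space M. \<not> \<bar>swap_diff i (sample t n \<omega>) (t n (n + 1) \<omega>)\<bar> < \<epsilon>}"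
  proof -
    have "D \<omega> \<in> space L" "rot (D \<omega>) \<in> space (TS (n + 1))" if "\<omega> \<in> space M" for \<omega>
      using measurable_space[OF D that] measurable_space[OF rot_meas] sets_eq_imp_space_eq[OF sets_L] by auto
    then show ?thesis
      by (intro arg_cong[where f = prob]) (auto simp: S_def H_rot)
  qed
  finally show ?thesis ..
qed

text \<open>Markov's inequality for the number of predictions that change by \<open>\<epsilon>\<close> or more, each of which changes
  with the same probability.\<close>

lemma prob_atypical_le:
  assumes "0 < \<eta>"
  shows "prob {\<omega> \<in> space M. atypical \<epsilon> \<eta> (sample t n \<omega>) (t n (n + 1) \<omega>)} \<le>
    prob {\<omega> \<in> space M. \<not> \<bar>stability_diff \<omega>\<bar> < \<epsilon>} / \<eta>"
proof -
  let ?at = "{\<omega> \<in> space M. atypical \<epsilon> \<eta> (sample t n \<omega>) (t n (n + 1) \<omega>)}"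
  let ?E = "\<lambda>i. {\<omega> \<in> space M. \<not> \<bar>swap_diff i (sample t n \<omega>) (t n (n + 1) \<omega>)\<bar> < \<epsilon>}"
  have E: "?E i \<in> events" if "i \<in> {1..n}" for i
    using measurable_swap_diff[OF that sample_measurable new_point_measurable] by measurable
  have at: "?at \<in> events"
    using pred_atypical[OF sample_measurable new_point_measurable] by (simp add: pred_def)
  have "(\<eta> * real n) * prob ?at = (\<integral>\<omega>. (\<eta> * real n) * indicator ?at \<omega> \<partial>M)"
    using at by simp
  also have "\<dots> \<le> (\<integral>\<omega>. (\<Sum>i=1..n. indicator (?E i) \<omega>) \<partial>M)"
  proof (rule integral_mono_AE)
    show "integrable M (\<lambda>\<omega>. (\<eta> * real n) * indicator ?at \<omega>)"
      using at by (intro integrable_mult_right) (simp add: emeasure_eq_measure)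
    show "integrable M (\<lambda>\<omega>. \<Sum>i=1..n. indicator (?E i) \<omega> :: real)"
      using E by (intro Bochner_Integration.integrable_sum) (simp add: emeasure_eq_measure)
    show "AE \<omega> in M. (\<eta> * real n) * indicator ?at \<omega> \<le> (\<Sum>i=1..n. indicator (?E i) \<omega>)"
    proof (rule AE_I2)
      fix \<omega> assume w: "\<omega> \<in> space M"
      have "(\<Sum>i=1..n. indicator (?E i) \<omega>) =
          real (card {i\<in>{1..n}. \<not> \<bar>swap_diff i (sample t n \<omega>) (t n (n + 1) \<omega>)\<bar> < \<epsilon>})"
        unfolding card_swap_diff using w by (intro sum.cong) (auto simp: indicator_def)
      then show "(\<eta> * real n) * indicator ?at \<omega> \<le> (\<Sum>i=1..n. indicator (?E i) \<omega>)"
        by (auto simp: atypical_def indicator_def simp del: sum_indicator_eq_card)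
    qed
  qed
  also have "\<dots> = (\<Sum>i=1..n. prob (?E i))"
    using E by (subst Bochner_Integration.integral_sum) (auto simp: emeasure_eq_measure)
  also have "\<dots> = real n * prob {\<omega> \<in> space M. \<not> \<bar>stability_diff \<omega>\<bar> < \<epsilon>}"
    using swap_diff_law by simp
  finally have "real n * (\<eta> * prob ?at) \<le> real n * prob {\<omega> \<in> space M. \<not> \<bar>stability_diff \<omega>\<bar> < \<epsilon>}"
    by (simp only: mult.assoc mult.left_commute[of \<eta>])
  then show ?thesis
    using two_le_n assms by (simp add: field_simps)
qed

end

section \<open>Distance of a miscoverage function from the nominal level\<close>

text \<open>Since the level is increasing as well, monotonicity alone allows restricting the suprema to rational
  levels: a level is approximated from above where the miscoverage exceeds it, and from below where
  it falls short of it. This makes the suprema measurable functions of the sample.\<close>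

lemma SUP_minus_rational:
  fixes g :: "real \<Rightarrow> real"
  assumes mono: "\<And>a b. a \<le> b \<Longrightarrow> g a \<le> g b" and le1: "\<And>a. g a \<le> 1"
  shows "(SUP \<alpha>\<in>{0..1}. g \<alpha> - \<alpha>) = (SUP \<alpha>\<in>{0..1} \<inter> \<rat>. g \<alpha> - \<alpha>)"
proof (rule antisym)
  have bdd: "bdd_above ((\<lambda>\<alpha>. g \<alpha> - \<alpha>) ` {0..1})"
    using le1 by (intro bdd_aboveI[of _ 1]) (auto intro: order_trans[OF diff_right_mono[OF le1]])
  then have bdd': "bdd_above ((\<lambda>\<alpha>. g \<alpha> - \<alpha>) ` ({0..1} \<inter> \<rat>))"
    by (rule bdd_above_mono) auto
  show "(SUP \<alpha>\<in>{0..1} \<inter> \<rat>. g \<alpha> - \<alpha>) \<le> (SUP \<alpha>\<in>{0..1}. g \<alpha> - \<alpha>)"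
    by (rule cSUP_subset_mono) (use bdd Rats_0 in \<open>auto simp: set_eq_iff intro!: exI[of _ 0]\<close>)
  show "(SUP \<alpha>\<in>{0..1}. g \<alpha> - \<alpha>) \<le> (SUP \<alpha>\<in>{0..1} \<inter> \<rat>. g \<alpha> - \<alpha>)"
  proof (rule cSUP_least)
    fix \<alpha> :: real assume a: "\<alpha> \<in> {0..1}"
    show "g \<alpha> - \<alpha> \<le> (SUP \<alpha>\<in>{0..1} \<inter> \<rat>. g \<alpha> - \<alpha>)"
    proof (cases "\<alpha> \<in> \<rat>")
      case True
      then show ?thesis using a by (intro cSUP_upper bdd') auto
    next
      case False
      then have "\<alpha> \<noteq> 1" by auto
      show ?thesis
      proof (rule field_le_epsilon)
        fix e :: real assume "0 < e"
        then obtain q where q: "q \<in> \<rat>" "\<alpha> < q" "q < min 1 (\<alpha> + e)"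
          using Rats_dense_in_real[of \<alpha> "min 1 (\<alpha> + e)"] a \<open>\<alpha> \<noteq> 1\<close> by auto
        have "g q - q \<le> (SUP \<alpha>\<in>{0..1} \<inter> \<rat>. g \<alpha> - \<alpha>)"
          using q a by (intro cSUP_upper bdd') auto
        then show "g \<alpha> - \<alpha> \<le> (SUP \<alpha>\<in>{0..1} \<inter> \<rat>. g \<alpha> - \<alpha>) + e"
          using q mono[of \<alpha> q] by simp
      qed
    qed
  qed simp
qed

lemma bdd_above_abs_minus:
  fixes g :: "real \<Rightarrow> real"
  assumes "\<And>a. 0 \<le> g a" "\<And>a. g a \<le> 1" "S \<subseteq> {0..1}"
  shows "bdd_above ((\<lambda>\<alpha>. \<bar>g \<alpha> - \<alpha>\<bar>) ` S)"
proof (rule bdd_aboveI2[where M = 1])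
  fix \<alpha> assume "\<alpha> \<in> S"
  then have "0 \<le> \<alpha>" "\<alpha> \<le> 1" using assms(3) by auto
  then show "\<bar>g \<alpha> - \<alpha>\<bar> \<le> 1" using assms(1)[of \<alpha>] assms(2)[of \<alpha>] by linarith
qed

lemma SUP_abs_minus_rational:
  fixes g :: "real \<Rightarrow> real"
  assumes mono: "\<And>a b. a \<le> b \<Longrightarrow> g a \<le> g b" and ge0: "\<And>a. 0 \<le> g a" and le1: "\<And>a. g a \<le> 1"
  shows "(SUP \<alpha>\<in>{0..1}. \<bar>g \<alpha> - \<alpha>\<bar>) = (SUP \<alpha>\<in>{0..1} \<inter> \<rat>. \<bar>g \<alpha> - \<alpha>\<bar>)"
    (is "?l = ?r")
proof (rule antisym)
  have bdd: "bdd_above ((\<lambda>\<alpha>. \<bar>g \<alpha> - \<alpha>\<bar>) ` {0..1})"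
    and bdd': "bdd_above ((\<lambda>\<alpha>. \<bar>g \<alpha> - \<alpha>\<bar>) ` ({0..1} \<inter> \<rat>))"
    by (rule bdd_above_abs_minus[OF ge0 le1]; simp)+
  show "?r \<le> ?l"
    by (rule cSUP_subset_mono) (use bdd Rats_0 in \<open>auto simp: set_eq_iff intro!: exI[of _ 0]\<close>)
  have up: "\<bar>g q - q\<bar> \<le> ?r" if "q \<in> {0..1}" "q \<in> \<rat>" for q
    using that by (intro cSUP_upper bdd') auto
  show "?l \<le> ?r"
  proof (rule cSUP_least)
    fix \<alpha> :: real assume a: "\<alpha> \<in> {0..1}"
    show "\<bar>g \<alpha> - \<alpha>\<bar> \<le> ?r"
    proof (cases "\<alpha> \<in> \<rat>")
      case True
      then show ?thesis using a up by blast
    next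
      case False
      then have ne: "\<alpha> \<noteq> 1" "\<alpha> \<noteq> 0" by auto
      show ?thesis
      proof (rule field_le_epsilon)
        fix e :: real assume e: "0 < e"
        obtain q where q: "q \<in> \<rat>" "\<alpha> < q" "q < min 1 (\<alpha> + e)"
          using Rats_dense_in_real[of \<alpha> "min 1 (\<alpha> + e)"] a ne e by auto
        obtain q' where q': "q' \<in> \<rat>" "max 0 (\<alpha> - e) < q'" "q' < \<alpha>"
          using Rats_dense_in_real[of "max 0 (\<alpha> - e)" \<alpha>] a ne e by auto
        have "\<bar>g q - q\<bar> \<le> ?r" "\<bar>g q' - q'\<bar> \<le> ?r"
          using q q' a by (auto intro!: up)
        then show "\<bar>g \<alpha> - \<alpha>\<bar> \<le> ?r + e"
          using q q' mono[of \<alpha> q] mono[of q' \<alpha>] by linarith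
      qed
    qed
  qed simp
qed

text \<open>Both gaps between a miscoverage function and the nominal level are stable under a shift of
  the level by \<open>h\<close> and of the value by \<open>c\<close>.\<close>

lemma SUP_minus_shift:
  fixes f g :: "real \<Rightarrow> real"
  assumes f: "\<And>a. f a \<le> 1" and g: "\<And>a. 0 \<le> g a" "\<And>a. g a \<le> 1"
    and h: "0 \<le> h" and c: "0 \<le> c" and le: "\<And>a. f a \<le> g (a + h) + c"
  shows "(SUP \<alpha>\<in>{0..1}. f \<alpha> - \<alpha>) \<le> (SUP \<alpha>\<in>{0..1}. g \<alpha> - \<alpha>) + h + c"
proof (rule cSUP_least)
  fix \<alpha> :: real assume a: "\<alpha> \<in> {0..1}"
  have "bdd_above ((\<lambda>\<alpha>. g \<alpha> - \<alpha>) ` {0..1})"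
    using g(2) by (intro bdd_aboveI2[where M = 1]) (auto intro: order_trans[OF diff_right_mono[OF g(2)]])
  then have up: "g b - b \<le> (SUP \<alpha>\<in>{0..1}. g \<alpha> - \<alpha>)" if "0 \<le> b" "b \<le> 1" for b
    using that by (intro cSUP_upper) auto
  show "f \<alpha> - \<alpha> \<le> (SUP \<alpha>\<in>{0..1}. g \<alpha> - \<alpha>) + h + c"
  proof (cases "\<alpha> + h \<le> 1")
    case True
    then show ?thesis
      using up[of "\<alpha> + h"] le[of \<alpha>] a h by simp
  next
    case False
    have "0 \<le> (SUP \<alpha>\<in>{0..1}. g \<alpha> - \<alpha>)"
      using up[of 0] g(1)[of 0] by simp
    then show ?thesis
      using f[of \<alpha>] False c by linarith
  qed
qed simp

lemma SUP_abs_minus_shift: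
  fixes f g :: "real \<Rightarrow> real"
  assumes f: "\<And>a. 0 \<le> f a" "\<And>a. f a \<le> 1" and g: "\<And>a. 0 \<le> g a" "\<And>a. g a \<le> 1"
    and h: "0 \<le> h" and c: "0 \<le> c"
    and le: "\<And>a. f a \<le> g (a + h) + c" "\<And>a. g a \<le> f (a + h) + c"
  shows "(SUP \<alpha>\<in>{0..1}. \<bar>f \<alpha> - \<alpha>\<bar>) \<le> (SUP \<alpha>\<in>{0..1}. \<bar>g \<alpha> - \<alpha>\<bar>) + h + c"
    (is "_ \<le> ?r + h + c")
proof (rule cSUP_least)
  fix \<alpha> :: real assume a: "\<alpha> \<in> {0..1}"
  have up: "\<bar>g b - b\<bar> \<le> ?r" if "0 \<le> b" "b \<le> 1" for b
    using that by (intro cSUP_upper bdd_above_abs_minus g) auto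
  have nonneg: "0 \<le> ?r"
    using up[of 0] by simp
  have "f \<alpha> - \<alpha> \<le> ?r + h + c"
  proof (cases "\<alpha> + h \<le> 1")
    case True
    then show ?thesis
      using up[of "\<alpha> + h"] le(1)[of \<alpha>] a h by (simp add: abs_le_iff)
  next
    case False
    then show ?thesis
      using f(2)[of \<alpha>] nonneg c by linarith
  qed
  moreover have "\<alpha> - f \<alpha> \<le> ?r + h + c"
  proof (cases "0 \<le> \<alpha> - h")
    case True
    then show ?thesis
      using up[of "\<alpha> - h"] le(2)[of "\<alpha> - h"] a h by (simp add: abs_le_iff)
  next
    case False
    then show ?thesis
      using f(1)[of \<alpha>] nonneg c by linarith
  qed
  ultimately show "\<bar>f \<alpha> - \<alpha>\<bar> \<le> ?r + h + c"
    by (simp add: abs_le_iff)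
qed simp


section \<open>Comparison of the conditional miscoverages\<close>

text \<open>The two properties of a family of prediction sets that make its conditional miscoverage a
  measurable function of the sample that is nondecreasing in the level.\<close>

definition (in prediction_model) nested_measurable :: "pred_set \<Rightarrow> bool" where
  "nested_measurable PS \<longleftrightarrow>
    (\<forall>\<alpha> \<delta>. Measurable.pred (TS n \<Otimes>\<^sub>M ZS) (\<lambda>w. fst (snd w) \<notin> PS n \<alpha> \<delta> (fst w) (snd (snd w)))) \<and>
    (\<forall>\<alpha> \<beta> \<delta> T x. \<alpha> \<le> \<beta> \<longrightarrow> PS n \<beta> \<delta> T x \<subseteq> PS n \<alpha> \<delta> T x)"

lemma (in prediction_model) nested_measurable_jackknife_set: "nested_measurable (jackknife_set Y A)"
proof -
  have "jackknife_set Y A n \<beta> \<delta> T x \<subseteq> jackknife_set Y A n \<alpha> \<delta> T x" if "\<alpha> \<le> \<beta>" for \<alpha> \<beta> \<delta> T x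
    unfolding jackknife_set_def using that
    by (auto intro: order_trans[OF _ add_right_mono[OF quantile_antimono]])
  then show ?thesis
    unfolding nested_measurable_def using pred_not_jackknife_set by blast
qed

lemma (in prediction_model) nested_measurable_full_conformal_set:
  "nested_measurable (full_conformal_set Y (in_sample_score (B_alg A)))"
proof -
  have "full_conformal_set Y (in_sample_score (B_alg A)) n \<beta> \<delta> T x \<subseteq>
      full_conformal_set Y (in_sample_score (B_alg A)) n \<alpha> \<delta> T x" if "\<alpha> \<le> \<beta>" for \<alpha> \<beta> \<delta> T x
    unfolding full_conformal_set_def using that
    by (auto intro: order_trans[OF _ add_right_mono[OF quantile_antimono]])
  then show ?thesis
    unfolding nested_measurable_def using pred_not_full_conformal_set by blast
qed

context iid_model
begin

abbreviation "misc PS \<alpha> \<delta> \<omega> \<equiv> cond_miscoverage \<kappa> PS n \<alpha> \<delta> (sample t n \<omega>)"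

lemma misc_eq:
  assumes "\<omega> \<in> space M"
  shows "misc PS \<alpha> \<delta> \<omega> =
    measure (\<kappa> n (sample t n \<omega>)) {z \<in> space ZS. fst z \<notin> PS n \<alpha> \<delta> (sample t n \<omega>) (snd z)}"
  unfolding cond_miscoverage_def kernel_prob(3)[OF sample_space[OF assms]] ..

lemma kernel_sets:
  assumes "\<omega> \<in> space M" and Q: "Measurable.pred (TS n \<Otimes>\<^sub>M ZS) (\<lambda>w. Q (fst w) (snd w))"
  shows "{z \<in> space ZS. Q (sample t n \<omega>) z} \<in> sets (\<kappa> n (sample t n \<omega>))"
  using measurable_compose[OF measurable_Pair1'[OF sample_space[OF assms(1)]] Q]
  unfolding kernel_prob(2)[OF sample_space[OF assms(1)]] by (simp add: pred_def)

lemma misc_sets: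
  assumes "nested_measurable PS" "\<omega> \<in> space M"
  shows "{z \<in> space ZS. fst z \<notin> PS n \<alpha> \<delta> (sample t n \<omega>) (snd z)} \<in> sets (\<kappa> n (sample t n \<omega>))"
  using assms(1) unfolding nested_measurable_def by (intro kernel_sets[OF assms(2)]) blast

lemma misc_bounds: "0 \<le> misc PS \<alpha> \<delta> \<omega>" "\<omega> \<in> space M \<Longrightarrow> misc PS \<alpha> \<delta> \<omega> \<le> 1"
  by (simp_all add: cond_miscoverage_def kernel_measure_bound)

lemma misc_mono:
  assumes PS: "nested_measurable PS" and w: "\<omega> \<in> space M" and "\<alpha> \<le> \<beta>"
  shows "misc PS \<alpha> \<delta> \<omega> \<le> misc PS \<beta> \<delta> \<omega>"
proof -
  interpret K: prob_space "\<kappa> n (sample t n \<omega>)"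
    by (rule kernel_prob(1)[OF sample_space[OF w]])
  have "PS n \<beta> \<delta> T x \<subseteq> PS n \<alpha> \<delta> T x" for T x
    using PS \<open>\<alpha> \<le> \<beta>\<close> unfolding nested_measurable_def by blast
  then show ?thesis
    unfolding misc_eq[OF w] by (intro K.finite_measure_mono misc_sets[OF PS w]) blast
qed

lemma misc_measurable:
  assumes "nested_measurable PS"
  shows "misc PS \<alpha> \<delta> \<in> borel_measurable M"
proof -
  have "(\<lambda>\<omega>. measure (\<kappa> n (sample t n \<omega>)) {z \<in> space ZS. fst z \<notin> PS n \<alpha> \<delta> (sample t n \<omega>) (snd z)})
      \<in> borel_measurable M"
    using assms unfolding nested_measurable_def by (intro kernel_measure_measurable) blast
  then show ?thesis
    by (subst measurable_cong[OF misc_eq])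
qed

text \<open>The two gaps between conditional miscoverage and level: one-sided in the notion of asymptotic
  conservativeness, two-sided in the notion of asymptotic exactness.\<close>

definition excess :: "pred_set \<Rightarrow> real \<Rightarrow> 'w \<Rightarrow> real" where
  "excess PS \<delta> \<omega> = (SUP \<alpha>\<in>{0..1}. misc PS \<alpha> \<delta> \<omega> - \<alpha>)"

definition deviation :: "pred_set \<Rightarrow> 'w \<Rightarrow> real" where
  "deviation PS \<omega> = (SUP \<alpha>\<in>{0..1}. \<bar>misc PS \<alpha> 0 \<omega> - \<alpha>\<bar>)"

lemma excess_measurable:
  assumes PS: "nested_measurable PS"
  shows "excess PS \<delta> \<in> borel_measurable M"
proof -
  have "(\<lambda>\<omega>. SUP \<alpha>\<in>{0..1} \<inter> \<rat>. misc PS \<alpha> \<delta> \<omega> - \<alpha>) \<in> borel_measurable M"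
  proof (rule borel_measurable_cSUP)
    show "countable ({0..1} \<inter> \<rat> :: real set)"
      using countable_rat by blast
    show "(\<lambda>\<omega>. misc PS \<alpha> \<delta> \<omega> - \<alpha>) \<in> borel_measurable M" for \<alpha>
      using misc_measurable[OF PS] by measurable
    fix \<omega> assume w: "\<omega> \<in> space M"
    have "misc PS \<alpha> \<delta> \<omega> - \<alpha> \<le> 1" if "\<alpha> \<in> {0..1} \<inter> \<rat>" for \<alpha>
      using misc_bounds(2)[OF w, of PS \<alpha> \<delta>] that by simp
    then show "bdd_above ((\<lambda>\<alpha>. misc PS \<alpha> \<delta> \<omega> - \<alpha>) ` ({0..1} \<inter> \<rat>))"
      by (rule bdd_aboveI2)
  qed
  moreover have "excess PS \<delta> \<omega> = (SUP \<alpha>\<in>{0..1} \<inter> \<rat>. misc PS \<alpha> \<delta> \<omega> - \<alpha>)" if "\<omega> \<in> space M" for \<omega>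
    unfolding excess_def by (intro SUP_minus_rational misc_mono[OF PS that] misc_bounds(2)[OF that])
  ultimately show ?thesis
    by (subst measurable_cong)
qed

lemma deviation_measurable:
  assumes PS: "nested_measurable PS"
  shows "deviation PS \<in> borel_measurable M"
proof -
  have "(\<lambda>\<omega>. SUP \<alpha>\<in>{0..1} \<inter> \<rat>. \<bar>misc PS \<alpha> 0 \<omega> - \<alpha>\<bar>) \<in> borel_measurable M"
  proof (rule borel_measurable_cSUP)
    show "countable ({0..1} \<inter> \<rat> :: real set)"
      using countable_rat by blast
    show "(\<lambda>\<omega>. \<bar>misc PS \<alpha> 0 \<omega> - \<alpha>\<bar>) \<in> borel_measurable M" for \<alpha>
      using misc_measurable[OF PS] by measurable
    fix \<omega> assume "\<omega> \<in> space M"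
    then show "bdd_above ((\<lambda>\<alpha>. \<bar>misc PS \<alpha> 0 \<omega> - \<alpha>\<bar>) ` ({0..1} \<inter> \<rat>))"
      by (intro bdd_above_abs_minus misc_bounds) auto
  qed
  moreover have "deviation PS \<omega> = (SUP \<alpha>\<in>{0..1} \<inter> \<rat>. \<bar>misc PS \<alpha> 0 \<omega> - \<alpha>\<bar>)" if "\<omega> \<in> space M" for \<omega>
    unfolding deviation_def by (intro SUP_abs_minus_rational misc_mono[OF PS that] misc_bounds that)
  ultimately show ?thesis
    by (subst measurable_cong)
qed

lemma deviation_bounds:
  assumes w: "\<omega> \<in> space M"
  shows "0 \<le> deviation PS \<omega>" "deviation PS \<omega> \<le> 1"
proof -
  have bdd: "bdd_above ((\<lambda>\<alpha>. \<bar>misc PS \<alpha> 0 \<omega> - \<alpha>\<bar>) ` {0..1})"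
    by (intro bdd_above_abs_minus misc_bounds w) auto
  have "\<bar>misc PS 0 0 \<omega> - 0\<bar> \<le> deviation PS \<omega>"
    unfolding deviation_def by (rule cSUP_upper[OF _ bdd]) simp
  then show "0 \<le> deviation PS \<omega>"
    by linarith
  show "deviation PS \<omega> \<le> 1"
    unfolding deviation_def
  proof (rule cSUP_least)
    fix \<alpha> :: real assume "\<alpha> \<in> {0..1}"
    then show "\<bar>misc PS \<alpha> 0 \<omega> - \<alpha>\<bar> \<le> 1"
      using misc_bounds(1)[of PS \<alpha> 0 \<omega>] misc_bounds(2)[OF w, of PS \<alpha> 0] by (auto simp: abs_le_iff)
  qed simp
qed

lemma deviation_integrable:
  assumes "nested_measurable PS"
  shows "integrable M (deviation PS)"
  using deviation_bounds
  by (intro integrable_const_bound[where B = 1] AE_I2 deviation_measurable assms) (simp add: abs_le_iff)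

abbreviation "jackknife \<equiv> jackknife_set Y A"
abbreviation "full_conformal \<equiv> full_conformal_set Y (in_sample_score (B_alg A))"

text \<open>Conditional probability that the new point is atypical.\<close>

definition atypical_prob :: "real \<Rightarrow> real \<Rightarrow> 'w \<Rightarrow> real" where
  "atypical_prob \<epsilon> \<eta> \<omega> = measure (\<kappa> n (sample t n \<omega>)) {z \<in> space ZS. atypical \<epsilon> \<eta> (sample t n \<omega>) z}"

lemma pred_atypical_pair: "Measurable.pred (TS n \<Otimes>\<^sub>M ZS) (\<lambda>w. atypical \<epsilon> \<eta> (fst w) (snd w))"
  by (rule pred_atypical[OF measurable_fst measurable_snd])

lemma atypical_prob_integrable: "integrable M (atypical_prob \<epsilon> \<eta>)"
  unfolding atypical_prob_def[abs_def] by (rule kernel_measure_integrable[OF pred_atypical_pair])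

lemma atypical_prob_nonneg: "0 \<le> atypical_prob \<epsilon> \<eta> \<omega>"
  by (simp add: atypical_prob_def)

lemma expectation_atypical_prob_le:
  "0 < \<eta> \<Longrightarrow> expectation (atypical_prob \<epsilon> \<eta>) \<le> prob {\<omega> \<in> space M. \<not> \<bar>stability_diff \<omega>\<bar> < \<epsilon>} / \<eta>"
  unfolding atypical_prob_def integral_kernel_measure[OF pred_atypical_pair] by (rule prob_atypical_le)

text \<open>The samples for which, up to a null set of new points, the features remain distinct.\<close>

definition distinct_sample :: "'w \<Rightarrow> bool" where
  "distinct_sample \<omega> \<longleftrightarrow> \<omega> \<in> space M \<and>
    (AE z in \<kappa> n (sample t n \<omega>). distinct_features (n + 1) (append_pt n (sample t n \<omega>) z))"

lemma AE_distinct_sample: "AE \<omega> in M. distinct_sample \<omega>"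
  using AE_kernel_distinct_features AE_space
  by eventually_elim (simp add: distinct_sample_def)

text \<open>If two prediction sets are nested off the exceptional set \<open>Q\<close> of new points, their miscoverages are
  ordered up to the conditional probability of \<open>Q\<close>.\<close>

lemma misc_le_of_subset:
  assumes w: "distinct_sample \<omega>" and PS': "nested_measurable PS'"
    and Q: "{z \<in> space ZS. Q z} \<in> sets (\<kappa> n (sample t n \<omega>))"
    and sub: "\<And>y x. distinct_features (n + 1) (append_pt n (sample t n \<omega>) (y, x)) \<Longrightarrow> \<not> Q (y, x) \<Longrightarrow>
        y \<in> PS' n \<beta> \<gamma> (sample t n \<omega>) x \<Longrightarrow> y \<in> PS n \<alpha> \<delta> (sample t n \<omega>) x"
  shows "misc PS \<alpha> \<delta> \<omega> \<le> misc PS' \<beta> \<gamma> \<omega> + measure (\<kappa> n (sample t n \<omega>)) {z \<in> space ZS. Q z}"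
proof -
  have w': "\<omega> \<in> space M" using w by (simp add: distinct_sample_def)
  interpret K: prob_space "\<kappa> n (sample t n \<omega>)"
    by (rule kernel_prob(1)[OF sample_space[OF w']])
  let ?S' = "{z \<in> space ZS. fst z \<notin> PS' n \<beta> \<gamma> (sample t n \<omega>) (snd z)}"
  have S': "?S' \<in> sets (\<kappa> n (sample t n \<omega>))"
    by (rule misc_sets[OF PS' w'])
  have dist: "AE z in \<kappa> n (sample t n \<omega>). distinct_features (n + 1) (append_pt n (sample t n \<omega>) z)"
    using w by (simp add: distinct_sample_def)
  have "misc PS \<alpha> \<delta> \<omega> \<le> measure (\<kappa> n (sample t n \<omega>)) (?S' \<union> {z \<in> space ZS. Q z})"
    unfolding misc_eq[OF w']
  proof (rule K.finite_measure_mono_AE)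
    show "AE z in \<kappa> n (sample t n \<omega>). z \<in> {z \<in> space ZS. fst z \<notin> PS n \<alpha> \<delta> (sample t n \<omega>) (snd z)} \<longrightarrow>
        z \<in> ?S' \<union> {z \<in> space ZS. Q z}"
      using dist
    proof eventually_elim
      case (elim z)
      then show ?case using sub[of "fst z" "snd z"] by auto
    qed
  qed (intro sets.Un S' Q)
  also have "\<dots> \<le> misc PS' \<beta> \<gamma> \<omega> + measure (\<kappa> n (sample t n \<omega>)) {z \<in> space ZS. Q z}"
    unfolding misc_eq[OF w'] by (rule measure_Un_le[OF S' Q])
  finally show ?thesis .
qed

lemma misc_full_conformal_le_jackknife:
  assumes "distinct_sample \<omega>"
  shows "misc full_conformal \<alpha> \<delta> \<omega> \<le>
    misc jackknife (\<alpha> + (\<eta> + 1 / (real n + 1))) (\<delta> - \<epsilon>) \<omega> + atypical_prob \<epsilon> \<eta> \<omega>"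
  unfolding atypical_prob_def
proof (rule misc_le_of_subset[OF assms nested_measurable_jackknife_set])
  have w: "\<omega> \<in> space M" using assms by (simp add: distinct_sample_def)
  show "{z \<in> space ZS. atypical \<epsilon> \<eta> (sample t n \<omega>) z} \<in> sets (\<kappa> n (sample t n \<omega>))"
    by (rule kernel_sets[OF w pred_atypical_pair])
  show "y \<in> full_conformal n \<alpha> \<delta> (sample t n \<omega>) x"
    if "distinct_features (n + 1) (append_pt n (sample t n \<omega>) (y, x))"
      "\<not> atypical \<epsilon> \<eta> (sample t n \<omega>) (y, x)"
      "y \<in> jackknife n (\<alpha> + (\<eta> + 1 / (real n + 1))) (\<delta> - \<epsilon>) (sample t n \<omega>) x" for y x
    using space_T_space_extensional[OF sample_space[OF w]] that by (rule jackknife_subset_full_conformal)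
qed

lemma misc_jackknife_le_full_conformal:
  assumes "distinct_sample \<omega>"
  shows "misc jackknife \<alpha> \<delta> \<omega> \<le>
    misc full_conformal (\<alpha> + (\<eta> + 1 / (real n + 1))) (\<delta> - \<epsilon>) \<omega> + atypical_prob \<epsilon> \<eta> \<omega>"
  unfolding atypical_prob_def
proof (rule misc_le_of_subset[OF assms nested_measurable_full_conformal_set])
  have w: "\<omega> \<in> space M" using assms by (simp add: distinct_sample_def)
  show "{z \<in> space ZS. atypical \<epsilon> \<eta> (sample t n \<omega>) z} \<in> sets (\<kappa> n (sample t n \<omega>))"
    by (rule kernel_sets[OF w pred_atypical_pair])
  show "y \<in> jackknife n \<alpha> \<delta> (sample t n \<omega>) x"
    if "distinct_features (n + 1) (append_pt n (sample t n \<omega>) (y, x))"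
      "\<not> atypical \<epsilon> \<eta> (sample t n \<omega>) (y, x)"
      "y \<in> full_conformal n (\<alpha> + (\<eta> + 1 / (real n + 1))) (\<delta> - \<epsilon>) (sample t n \<omega>) x" for y x
    using space_T_space_extensional[OF sample_space[OF w]] that by (rule full_conformal_subset_jackknife)
qed

text \<open>The radius of the jackknife interval depends on the sample only. If the conditional density
  of the score is at most \<open>K\<close>, reducing that radius by \<open>\<epsilon>\<close> changes the miscoverage by
  at most \<open>K * \<epsilon>\<close>.\<close>

lemma misc_jackknife_deflate:
  assumes w: "distinct_sample \<omega>" and "0 \<le> \<epsilon>" "0 \<le> K"
    and dens: "distributed (\<kappa> n (sample t n \<omega>)) lborel
      (\<lambda>z. in_sample_score (B_alg A) n n z (sample t n \<omega>)) (\<lambda>s. ennreal (f s))"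
    and bound: "\<And>s. f s \<le> K"
  shows "misc jackknife \<alpha> (\<delta> - \<epsilon>) \<omega> \<le> misc jackknife \<alpha> \<delta> \<omega> + K * \<epsilon>"
proof -
  let ?T = "sample t n \<omega>"
  let ?C = "\<lambda>z. in_sample_score (B_alg A) n n z ?T"
  have w': "\<omega> \<in> space M" using w by (simp add: distinct_sample_def)
  interpret K: prob_space "\<kappa> n ?T"
    by (rule kernel_prob(1)[OF sample_space[OF w']])
  have sp: "space (\<kappa> n ?T) = space ZS"
    by (rule kernel_prob(3)[OF sample_space[OF w']])
  define q where "q = quantile (emp_cdf n (\<lambda>i. \<bar>loo_residual A n ?T i\<bar>)) (1 - \<alpha>)"
  define r where "r = real_of_ereal q + \<delta>"
  let ?S = "{z \<in> space ZS. ?C z \<in> {r - \<epsilon>..r}}"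
  have S_eq: "?S = ?C -` {r - \<epsilon>..r} \<inter> space (\<kappa> n ?T)"
    using sp by auto
  have "?C \<in> borel_measurable (\<kappa> n ?T)"
    using dens by (simp add: distributed_def)
  then have S: "?S \<in> sets (\<kappa> n ?T)"
    unfolding S_eq by measurable
  have "misc jackknife \<alpha> (\<delta> - \<epsilon>) \<omega> \<le> misc jackknife \<alpha> \<delta> \<omega> + measure (\<kappa> n ?T) ?S"
  proof (rule misc_le_of_subset[OF w nested_measurable_jackknife_set S])
    fix y x assume dist: "distinct_features (n + 1) (append_pt n ?T (y, x))"
      and out: "\<not> ?C (y, x) \<in> {r - \<epsilon>..r}" and inside: "y \<in> jackknife n \<alpha> \<delta> ?T x"
    have C: "?C (y, x) = \<bar>y - A n n x ?T\<bar>"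
      using score_new_point[OF _ space_T_space_extensional[OF sample_space[OF w']] dist, of A] two_le_n
      by simp
    have "y \<in> Y n" and le: "ereal (?C (y, x)) \<le> q + ereal \<delta>"
      using inside by (auto simp: jackknife_set_def q_def C)
    moreover have "ereal (?C (y, x)) \<le> q + ereal (\<delta> - \<epsilon>)"
      using le out by (cases q) (auto simp: r_def)
    ultimately show "y \<in> jackknife n \<alpha> (\<delta> - \<epsilon>) ?T x"
      by (simp add: jackknife_set_def q_def C)
  qed
  moreover have "measure (\<kappa> n ?T) ?S \<le> K * \<epsilon>"
  proof -
    have "ennreal (measure (\<kappa> n ?T) ?S) = (\<integral>\<^sup>+s. ennreal (f s) * indicator {r - \<epsilon>..r} s \<partial>lborel)"
      unfolding S_eq using distributed_emeasure[OF dens, of "{r - \<epsilon>..r}"]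
      by (simp only: K.emeasure_eq_measure sets_lborel atLeastAtMost_borel)
    also have "\<dots> \<le> (\<integral>\<^sup>+s. ennreal K * indicator {r - \<epsilon>..r} s \<partial>lborel)"
      using bound by (intro nn_integral_mono mult_right_mono ennreal_leI) auto
    also have "\<dots> = ennreal (K * \<epsilon>)"
      using \<open>0 \<le> \<epsilon>\<close> \<open>0 \<le> K\<close> by (simp add: nn_integral_cmult_indicator ennreal_mult)
    finally show ?thesis
      using \<open>0 \<le> \<epsilon>\<close> \<open>0 \<le> K\<close> by (simp add: ennreal_le_iff)
  qed
  ultimately show ?thesis by linarith
qed

lemma prob_excess_le:
  assumes PS: "nested_measurable PS" "nested_measurable PS'"
    and compare: "\<And>\<omega> \<alpha>. distinct_sample \<omega> \<Longrightarrow>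
      misc PS \<alpha> \<delta> \<omega> \<le> misc PS' (\<alpha> + (\<eta> + 1 / (real n + 1))) \<gamma> \<omega> + atypical_prob \<epsilon> \<eta> \<omega>"
    and "0 < \<eta>" "0 < e" and h: "\<eta> + 1 / (real n + 1) \<le> e / 3"
  shows "prob {\<omega> \<in> space M. excess PS \<delta> \<omega> \<ge> e} \<le>
    prob {\<omega> \<in> space M. excess PS' \<gamma> \<omega> \<ge> e / 3} +
    prob {\<omega> \<in> space M. \<not> \<bar>stability_diff \<omega>\<bar> < \<epsilon>} / \<eta> / (e / 3)"
proof -
  let ?E = "{\<omega> \<in> space M. excess PS' \<gamma> \<omega> \<ge> e / 3}" and ?B = "{\<omega> \<in> space M. atypical_prob \<epsilon> \<eta> \<omega> \<ge> e / 3}"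
  have E: "?E \<in> events"
    using excess_measurable[OF PS(2)] by measurable
  have B: "?B \<in> events"
    using borel_measurable_integrable[OF atypical_prob_integrable] by measurable
  have "prob {\<omega> \<in> space M. excess PS \<delta> \<omega> \<ge> e} \<le> prob (?E \<union> ?B)"
  proof (rule finite_measure_mono_AE)
    show "AE \<omega> in M. \<omega> \<in> {\<omega> \<in> space M. excess PS \<delta> \<omega> \<ge> e} \<longrightarrow> \<omega> \<in> ?E \<union> ?B"
      using AE_distinct_sample
    proof eventually_elim
      case (elim \<omega>)
      then have w: "\<omega> \<in> space M" by (simp add: distinct_sample_def)
      have "excess PS \<delta> \<omega> \<le> excess PS' \<gamma> \<omega> + (\<eta> + 1 / (real n + 1)) + atypical_prob \<epsilon> \<eta> \<omega>"
        unfolding excess_def using \<open>0 < \<eta>\<close>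
        by (intro SUP_minus_shift misc_bounds w atypical_prob_nonneg compare elim) auto
      then show ?case
        using h by auto
    qed
  qed (intro sets.Un E B)
  also have "\<dots> \<le> prob ?E + prob ?B"
    by (rule measure_Un_le[OF E B])
  also have "prob ?B \<le> expectation (atypical_prob \<epsilon> \<eta>) / (e / 3)"
    using \<open>0 < e\<close> atypical_prob_nonneg
    by (intro integral_Markov_inequality_measure[where A = "space M"] atypical_prob_integrable) auto
  also have "\<dots> \<le> prob {\<omega> \<in> space M. \<not> \<bar>stability_diff \<omega>\<bar> < \<epsilon>} / \<eta> / (e / 3)"
    using \<open>0 < e\<close> by (intro divide_right_mono expectation_atypical_prob_le \<open>0 < \<eta>\<close>) auto
  finally show ?thesis by simp
qed

text \<open>Outside an event of small probability the density of the score is bounded, and the gap of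
  either prediction set controls the gap of the other one.\<close>

lemma expectation_deviation_le:
  assumes "0 < \<eta>" "0 \<le> \<epsilon>" "0 \<le> K" and E: "E \<in> events"
    and dens: "AE \<omega> in M. \<omega> \<notin> E \<longrightarrow> (\<exists>f. distributed (\<kappa> n (sample t n \<omega>)) lborel
      (\<lambda>z. in_sample_score (B_alg A) n n z (sample t n \<omega>)) (\<lambda>s. ennreal (f s)) \<and> (\<forall>s. f s \<le> K))"
  defines "c \<equiv> \<eta> + 1 / (real n + 1) + K * \<epsilon> + prob {\<omega> \<in> space M. \<not> \<bar>stability_diff \<omega>\<bar> < \<epsilon>} / \<eta> + prob E"
  shows "expectation (deviation full_conformal) \<le> expectation (deviation jackknife) + c"
    and "expectation (deviation jackknife) \<le> expectation (deviation full_conformal) + c"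
proof -
  let ?h = "\<eta> + 1 / (real n + 1)"
  have pointwise: "AE \<omega> in M.
      deviation full_conformal \<omega> \<le> deviation jackknife \<omega> + (?h + K * \<epsilon> + atypical_prob \<epsilon> \<eta> \<omega> + indicator E \<omega>) \<and>
      deviation jackknife \<omega> \<le> deviation full_conformal \<omega> + (?h + K * \<epsilon> + atypical_prob \<epsilon> \<eta> \<omega> + indicator E \<omega>)"
    using AE_distinct_sample dens
  proof eventually_elim
    case (elim \<omega>)
    then have w: "\<omega> \<in> space M" by (simp add: distinct_sample_def)
    show ?case
    proof (cases "\<omega> \<in> E")
      \<comment> \<open>deviations lie between 0 and 1, so the indicator of \<open>E\<close> alone suffices\<close>
      case True
      have "0 \<le> ?h" "0 \<le> K * \<epsilon>" using assms by auto
      then show ?thesis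
        using True deviation_bounds[OF w, of full_conformal] deviation_bounds[OF w, of jackknife]
          atypical_prob_nonneg[of \<epsilon> \<eta> \<omega>] by simp
    next
      case False
      then obtain f where f: "distributed (\<kappa> n (sample t n \<omega>)) lborel
          (\<lambda>z. in_sample_score (B_alg A) n n z (sample t n \<omega>)) (\<lambda>s. ennreal (f s))" "\<And>s. f s \<le> K"
        using elim(2) by blast
      note deflate = misc_jackknife_deflate[OF elim(1) \<open>0 \<le> \<epsilon>\<close> \<open>0 \<le> K\<close> f]
      \<comment> \<open>Only the jackknife radius is a function of the sample, so in both directions it is the jackknife
        set whose inflation is changed.\<close>
      have 1: "misc full_conformal \<alpha> 0 \<omega> \<le> misc jackknife (\<alpha> + ?h) 0 \<omega> + (K * \<epsilon> + atypical_prob \<epsilon> \<eta> \<omega>)" for \<alpha>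
        using misc_full_conformal_le_jackknife[OF elim(1), of \<alpha> 0 \<eta> \<epsilon>] deflate[of "\<alpha> + ?h" 0] by simp
      have 2: "misc jackknife \<alpha> 0 \<omega> \<le> misc full_conformal (\<alpha> + ?h) 0 \<omega> + (K * \<epsilon> + atypical_prob \<epsilon> \<eta> \<omega>)" for \<alpha>
        using misc_jackknife_le_full_conformal[OF elim(1), of \<alpha> \<epsilon> \<eta> \<epsilon>] deflate[of \<alpha> \<epsilon>] by simp
      have nonneg: "0 \<le> ?h" "0 \<le> K * \<epsilon> + atypical_prob \<epsilon> \<eta> \<omega>"
        using assms atypical_prob_nonneg[of \<epsilon> \<eta> \<omega>] by auto
      have "deviation full_conformal \<omega> \<le> deviation jackknife \<omega> + ?h + (K * \<epsilon> + atypical_prob \<epsilon> \<eta> \<omega>)"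
        unfolding deviation_def by (intro SUP_abs_minus_shift misc_bounds w nonneg 1 2)
      moreover have "deviation jackknife \<omega> \<le> deviation full_conformal \<omega> + ?h + (K * \<epsilon> + atypical_prob \<epsilon> \<eta> \<omega>)"
        unfolding deviation_def by (intro SUP_abs_minus_shift misc_bounds w nonneg 1 2)
      ultimately show ?thesis
        using False by simp
    qed
  qed
  have int_E: "integrable M (indicator E :: 'w \<Rightarrow> real)"
    using E by (simp add: emeasure_eq_measure)
  have "expectation (deviation PS) \<le> expectation (deviation PS') + c"
    if PS: "nested_measurable PS" "nested_measurable PS'"
      and le: "AE \<omega> in M. deviation PS \<omega> \<le>
        deviation PS' \<omega> + (?h + K * \<epsilon> + atypical_prob \<epsilon> \<eta> \<omega> + indicator E \<omega>)" for PS PS'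
  proof -
    have "expectation (deviation PS) \<le>
        (\<integral>\<omega>. deviation PS' \<omega> + (?h + K * \<epsilon> + atypical_prob \<epsilon> \<eta> \<omega> + indicator E \<omega>) \<partial>M)"
      by (intro integral_mono_AE le deviation_integrable PS Bochner_Integration.integrable_add
          atypical_prob_integrable int_E integrable_const)
    also have "\<dots> = expectation (deviation PS') + (?h + K * \<epsilon> + expectation (atypical_prob \<epsilon> \<eta>) + prob E)"
      using E by (simp add: deviation_integrable PS atypical_prob_integrable int_E prob_space)
    also have "\<dots> \<le> expectation (deviation PS') + c"
      unfolding c_def using expectation_atypical_prob_le[OF \<open>0 < \<eta>\<close>, of \<epsilon>] by simp
    finally show ?thesis .
  qed
  note this[OF nested_measurable_full_conformal_set nested_measurable_jackknife_set]
    this[OF nested_measurable_jackknife_set nested_measurable_full_conformal_set]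
  then show "expectation (deviation full_conformal) \<le> expectation (deviation jackknife) + c"
    and "expectation (deviation jackknife) \<le> expectation (deviation full_conformal) + c"
    using pointwise by auto
qed

lemma AE_jackknife_eq_shortcut:
  "AE \<omega> in M. \<forall>\<alpha>\<in>{0..1}. \<forall>\<delta>\<ge>0.
     jackknife n \<alpha> \<delta> (sample t n \<omega>) (snd (t n (n + 1) \<omega>)) =
     shortcut_set Y (in_sample_score (B_alg A)) n \<alpha> \<delta> (sample t n \<omega>) (snd (t n (n + 1) \<omega>))"
  using AE_distinct_features AE_space
proof eventually_elim
  case (elim \<omega>)
  let ?T = "sample t n \<omega>" and ?x = "snd (t n (n + 1) \<omega>)"
  have ext: "?T \<in> extensional {1..n}"
    by (rule space_T_space_extensional[OF sample_space[OF elim(2)]])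
  have "distinct_features (n + 1) (append_pt n ?T (y, ?x))" for y
  proof -
    have "(\<lambda>i. snd (append_pt n ?T (y, ?x) i)) = (\<lambda>i. snd (append_pt n ?T (t n (n + 1) \<omega>) i))"
      by (auto simp: append_pt_def)
    then show ?thesis
      using elim(1) unfolding distinct_features_def by simp
  qed
  then have new: "in_sample_score (B_alg A) n n (y, ?x) ?T = \<bar>y - A n n ?x ?T\<bar>" for y
    using score_new_point[OF _ ext, of "(y, ?x)" A] two_le_n by simp
  have old: "emp_cdf n (\<lambda>i. in_sample_score (B_alg A) n (n - 1) (?T i) (remove_pt n ?T i)) =
      emp_cdf n (\<lambda>i. \<bar>loo_residual A n ?T i\<bar>)"
    unfolding emp_cdf_def using score_leave_one_out[OF two_le_n _ distinct_features_append_ptD[OF elim(1)]]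
    by (auto simp: fun_eq_iff intro!: sum.cong)
  then show ?case
    unfolding jackknife_set_def shortcut_set_def new old by simp
qed

lemma AE_score_diff_le:
  "AE \<omega> in M. \<bar>in_sample_score (B_alg A) n n (t n (n + 1) \<omega>) (sample t n \<omega>) -
     in_sample_score (B_alg A) n (n - 1) (t n (n + 1) \<omega>) (remove_pt n (sample t n \<omega>) n)\<bar>
     \<le> \<bar>stability_diff \<omega>\<bar>"
  using AE_distinct_features AE_space
proof eventually_elim
  case (elim \<omega>)
  let ?T = "sample t n \<omega>" and ?z = "t n (n + 1) \<omega>"
  have new: "in_sample_score (B_alg A) n n ?z ?T = \<bar>fst ?z - A n n (snd ?z) ?T\<bar>"
    using two_le_n by (intro score_new_point space_T_space_extensional[OF sample_space] elim) auto
  have old: "in_sample_score (B_alg A) n (n - 1) ?z (remove_pt n ?T n) =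
      \<bar>fst ?z - A n (n - 1) (snd ?z) (remove_pt n ?T n)\<bar>"
  proof (rule in_sample_score_fresh)
    fix i assume "i \<in> {1..n - 1}"
    then show "snd (remove_pt n ?T n i) \<noteq> snd ?z"
      using distinct_featuresD[OF elim(1), of i "n + 1"] by (auto simp: remove_pt_def append_pt_def)
  qed (use two_le_n remove_pt_extensional[of "n - 1" ?T n] in auto)
  show ?case
    unfolding stability_diff_def new old by linarith
qed

lemma prob_score_diff_le:
  "prob {\<omega> \<in> space M. \<bar>\<bar>in_sample_score (B_alg A) n n (t n (n + 1) \<omega>) (sample t n \<omega>) -
     in_sample_score (B_alg A) n (n - 1) (t n (n + 1) \<omega>) (remove_pt n (sample t n \<omega>) n)\<bar>\<bar> \<ge> \<epsilon>}
   \<le> prob {\<omega> \<in> space M. \<bar>stability_diff \<omega>\<bar> \<ge> \<epsilon>}"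
proof (rule finite_measure_mono_AE)
  show "{\<omega> \<in> space M. \<bar>stability_diff \<omega>\<bar> \<ge> \<epsilon>} \<in> events"
    using stability_diff_measurable by measurable
qed (use AE_score_diff_le in eventually_elim, auto)

end

section \<open>Asymptotic equivalence\<close>

theorem theoremA5:
  fixes Y :: "nat \<Rightarrow> real set" and p :: "nat \<Rightarrow> nat"
    and P :: "nat \<Rightarrow> point measure"
    and M :: "nat \<Rightarrow> 'w measure" and t :: "nat \<Rightarrow> nat \<Rightarrow> 'w \<Rightarrow> point"
    and \<kappa> :: "nat \<Rightarrow> training \<Rightarrow> point measure"
    and A :: algorithm and C :: score
  assumes interval: "\<And>n. n \<ge> 1 \<Longrightarrow> is_interval (Y n)"
    and P_prob: "\<And>n. n \<ge> 1 \<Longrightarrow> prob_space (P n)"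
    and P_sets: "\<And>n. n \<ge> 1 \<Longrightarrow> sets (P n) = sets (Z_space (Y n) (p n))"
    and M_prob: "\<And>n. n \<ge> 1 \<Longrightarrow> prob_space (M n)"
    and indep: "\<And>n. n \<ge> 1 \<Longrightarrow>
      prob_space.indep_vars (M n) (\<lambda>_. Z_space (Y n) (p n)) (t n) {1..n + 1}"
    and ident: "\<And>n i. n \<ge> 1 \<Longrightarrow> i \<in> {1..n + 1} \<Longrightarrow>
      distr (M n) (Z_space (Y n) (p n)) (t n i) = P n"
    and cond: "\<And>n. n \<ge> 1 \<Longrightarrow>
      regular_cond_distr (M n) (T_space (Y n) (p n) n) (sample t n)
        (Z_space (Y n) (p n)) (t n (n + 1)) (\<kappa> n)"
    and nonatomic: "\<And>n. n \<ge> 1 \<Longrightarrow> nonatomic (distr (P n) (X_space (p n)) snd)"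
    and algorithm: "prediction_algorithm Y p A"
    and symmetric: "symmetric_algorithm Y p A"
    and stable: "out_of_sample_stable M t A"
    and C_def: "C = in_sample_score (B_alg A)"
  shows
    "(\<forall>n\<ge>2. AE \<omega> in M n. \<forall>\<alpha>\<in>{0..1}. \<forall>\<delta>\<ge>0.
        jackknife_set Y A n \<alpha> \<delta> (sample t n \<omega>) (snd (t n (n + 1) \<omega>)) =
        shortcut_set Y C n \<alpha> \<delta> (sample t n \<omega>) (snd (t n (n + 1) \<omega>))) \<and>
     stable_score M t C \<and>
     (asymp_conservative M t \<kappa> (full_conformal_set Y C) \<longleftrightarrow>
      asymp_conservative M t \<kappa> (jackknife_set Y A)) \<and>
     (continuous_case M t \<kappa> C \<longrightarrow>
       (asymp_exact M t \<kappa> (full_conformal_set Y C) \<longleftrightarrow>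
        asymp_exact M t \<kappa> (jackknife_set Y A)))"
proof -
  let ?F = "full_conformal_set Y C" and ?J = "jackknife_set Y A"
  have model: "iid_model Y p A n (M n) (P n) t \<kappa>" if "2 \<le> n" for n
  proof -
    have "1 \<le> n" using that by simp
    then show ?thesis
      using algorithm that P_prob P_sets M_prob indep ident cond nonatomic
      unfolding prediction_algorithm_def
      by (intro iid_model.intro prediction_model.intro iid_model_axioms.intro) blast+
  qed
  define a where "a \<epsilon> n = measure (M n) {\<omega> \<in> space (M n).
      \<bar>A n n (snd (t n (n + 1) \<omega>)) (sample t n \<omega>) -
       A n (n - 1) (snd (t n (n + 1) \<omega>)) (remove_pt n (sample t n \<omega>) n)\<bar> \<ge> \<epsilon>}" for \<epsilon> n
  have a_lim: "a \<epsilon> \<longlonglongrightarrow> 0" if "0 < \<epsilon>" for \<epsilon>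
    using stable that unfolding out_of_sample_stable_def to_zero_in_prob_def a_def by blast
  have a_model: "measure (M n) {\<omega> \<in> space (M n). \<not> \<bar>iid_model.stability_diff A n t \<omega>\<bar> < \<epsilon>} = a \<epsilon> n"
    if "2 \<le> n" for \<epsilon> n
    unfolding a_def iid_model.stability_diff_def[OF model[OF that]] not_less ..
  have lim_n: "(\<lambda>n. 1 / (real n + 1)) \<longlonglongrightarrow> 0"
    using LIMSEQ_inverse_real_of_nat by (simp add: inverse_eq_divide add.commute)

  have "\<forall>n\<ge>2. AE \<omega> in M n. \<forall>\<alpha>\<in>{0..1}. \<forall>\<delta>\<ge>0.
      ?J n \<alpha> \<delta> (sample t n \<omega>) (snd (t n (n + 1) \<omega>)) =
      shortcut_set Y C n \<alpha> \<delta> (sample t n \<omega>) (snd (t n (n + 1) \<omega>))"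
    unfolding C_def using iid_model.AE_jackknife_eq_shortcut[OF model] by blast

  moreover have "stable_score M t C"
    unfolding stable_score_def to_zero_in_prob_def
  proof (intro allI impI)
    fix \<epsilon> :: real assume "0 < \<epsilon>"
    let ?s = "\<lambda>n. measure (M n) {\<omega> \<in> space (M n). \<bar>\<bar>C n n (t n (n + 1) \<omega>) (sample t n \<omega>) -
      C n (n - 1) (t n (n + 1) \<omega>) (remove_pt n (sample t n \<omega>) n)\<bar>\<bar> \<ge> \<epsilon>}"
    show "?s \<longlonglongrightarrow> 0"
    proof (rule tendsto_sandwich[OF _ _ tendsto_const a_lim[OF \<open>0 < \<epsilon>\<close>]])
      show "\<forall>\<^sub>F n in sequentially. ?s n \<le> a \<epsilon> n"
        using eventually_ge_at_top[of 2]
      proof eventually_elim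
        case (elim n)
        then show ?case
          using iid_model.prob_score_diff_le[OF model[OF elim], of \<epsilon>] a_model[OF elim, of \<epsilon>]
          by (simp only: C_def not_less)
      qed
    qed simp
  qed

  moreover have "asymp_conservative M t \<kappa> ?F \<longleftrightarrow> asymp_conservative M t \<kappa> ?J"
  proof -
    define X where "X PS \<delta> e n = measure (M n) {\<omega> \<in> space (M n).
        (SUP \<alpha>\<in>{0..1}. cond_miscoverage \<kappa> PS n \<alpha> \<delta> (sample t n \<omega>) - \<alpha>) \<ge> e}" for PS \<delta> e n
    have asymp_X: "asymp_conservative M t \<kappa> PS \<longleftrightarrow> (\<forall>\<delta>>0. \<forall>e>0. X PS \<delta> e \<longlonglongrightarrow> 0)" for PS
      unfolding asymp_conservative_def X_def ..
    \<comment> \<open>Half of the inflation pays for the shift of the quantiles; the level shift, the excess of the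
      other set and the atypical points each get a third of \<open>e\<close>.\<close>
    have X_le: "X ?F \<delta> e n \<le> X ?J (\<delta> / 2) (e / 3) n + a (\<delta> / 2) n / (e / 6) / (e / 3)"
        "X ?J \<delta> e n \<le> X ?F (\<delta> / 2) (e / 3) n + a (\<delta> / 2) n / (e / 6) / (e / 3)"
      if n: "2 \<le> n" and e: "0 < e" and h: "1 / (real n + 1) \<le> e / 6" for \<delta> e n
    proof -
      interpret iid_model Y p A n "M n" "P n" t \<kappa>
        by (rule model[OF n])
      have sum: "e / 6 + 1 / (real n + 1) \<le> e / 3" "0 < e / 6"
        using h e by auto
      note le = prob_excess_le[where \<delta> = \<delta> and \<gamma> = "\<delta> / 2" and \<epsilon> = "\<delta> / 2", OF _ _ _ sum(2) e sum(1),
          unfolded excess_def a_model[OF n]]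
      show "X ?F \<delta> e n \<le> X ?J (\<delta> / 2) (e / 3) n + a (\<delta> / 2) n / (e / 6) / (e / 3)"
        unfolding X_def C_def
        by (rule le[OF nested_measurable_full_conformal_set nested_measurable_jackknife_set])
           (use misc_full_conformal_le_jackknife[where \<delta> = \<delta> and \<epsilon> = "\<delta> / 2"] in simp)
      show "X ?J \<delta> e n \<le> X ?F (\<delta> / 2) (e / 3) n + a (\<delta> / 2) n / (e / 6) / (e / 3)"
        unfolding X_def C_def
        by (rule le[OF nested_measurable_jackknife_set nested_measurable_full_conformal_set])
           (use misc_jackknife_le_full_conformal[where \<delta> = \<delta> and \<epsilon> = "\<delta> / 2"] in simp)
    qed
    have transfer: "asymp_conservative M t \<kappa> PS"
      if PS': "asymp_conservative M t \<kappa> PS'"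
        and le: "\<And>n \<delta> e. 2 \<le> n \<Longrightarrow> 0 < e \<Longrightarrow> 1 / (real n + 1) \<le> e / 6 \<Longrightarrow>
          X PS \<delta> e n \<le> X PS' (\<delta> / 2) (e / 3) n + a (\<delta> / 2) n / (e / 6) / (e / 3)" for PS PS'
      unfolding asymp_X
    proof (intro allI impI)
      fix \<delta> e :: real assume "0 < \<delta>" "0 < e"
      have "X PS' (\<delta> / 2) (e / 3) \<longlonglongrightarrow> 0"
        using PS' \<open>0 < \<delta>\<close> \<open>0 < e\<close> unfolding asymp_X by simp
      moreover have "(\<lambda>n. a (\<delta> / 2) n / (e / 6) / (e / 3)) \<longlonglongrightarrow> 0 / (e / 6) / (e / 3)"
        using \<open>0 < \<delta>\<close> \<open>0 < e\<close> by (intro tendsto_divide a_lim tendsto_const) auto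
      ultimately have lim: "(\<lambda>n. X PS' (\<delta> / 2) (e / 3) n + a (\<delta> / 2) n / (e / 6) / (e / 3)) \<longlonglongrightarrow> 0"
        using tendsto_add by fastforce
      have small: "\<forall>\<^sub>F n in sequentially. 1 / (real n + 1) < e / 6"
        using \<open>0 < e\<close> by (intro order_tendstoD(2)[OF lim_n]) simp
      show "X PS \<delta> e \<longlonglongrightarrow> 0"
      proof (rule tendsto_sandwich[OF _ _ tendsto_const lim])
        show "\<forall>\<^sub>F n in sequentially. X PS \<delta> e n \<le> X PS' (\<delta> / 2) (e / 3) n + a (\<delta> / 2) n / (e / 6) / (e / 3)"
          using small eventually_ge_at_top[of 2] by eventually_elim (rule le[OF _ \<open>0 < e\<close> less_imp_le])
      qed (simp add: X_def)
    qed
    show ?thesis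
      using transfer[OF _ X_le(1)] transfer[OF _ X_le(2)] by blast
  qed

  moreover have "asymp_exact M t \<kappa> ?F \<longleftrightarrow> asymp_exact M t \<kappa> ?J" if CC: "continuous_case M t \<kappa> C"
  proof -
    define D where "D PS n = (LINT \<omega>|M n.
        (SUP \<alpha>\<in>{0..1}. \<bar>cond_miscoverage \<kappa> PS n \<alpha> 0 (sample t n \<omega>) - \<alpha>\<bar>))" for PS n
    have asymp_D: "asymp_exact M t \<kappa> PS \<longleftrightarrow> D PS \<longlonglongrightarrow> 0" for PS
      unfolding asymp_exact_def D_def ..
    have D_nonneg: "0 \<le> D PS n" if n: "2 \<le> n" for PS n
    proof -
      interpret iid_model Y p A n "M n" "P n" t \<kappa>
        by (rule model[OF n])
      show ?thesis
        using deviation_bounds(1) unfolding D_def deviation_def by (intro integral_nonneg_AE AE_I2)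
    qed
    obtain f where f: "\<And>n. 1 \<le> n \<Longrightarrow> AE \<omega> in M n.
          distributed (\<kappa> n (sample t n \<omega>)) lborel (\<lambda>z. C n n z (sample t n \<omega>)) (\<lambda>s. ennreal (f n (sample t n \<omega>) s))"
      and f_bdd: "stochastically_bounded M (\<lambda>n \<omega>. SUP s. ereal \<bar>f n (sample t n \<omega>) s\<bar>)"
      using CC unfolding continuous_case_def by blast
    have D_le: "\<exists>K\<ge>0. \<forall>n\<ge>2. \<forall>\<eta>>0. \<forall>\<epsilon>\<ge>0.
        D ?F n \<le> D ?J n + (\<eta> + 1 / (real n + 1) + K * \<epsilon> + a \<epsilon> n / \<eta> + \<rho>) \<and>
        D ?J n \<le> D ?F n + (\<eta> + 1 / (real n + 1) + K * \<epsilon> + a \<epsilon> n / \<eta> + \<rho>)" if "0 < \<rho>" for \<rho>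
    proof -
      obtain K0 :: real where K0: "\<And>n. 1 \<le> n \<Longrightarrow> outer_measure_of (M n)
          {\<omega> \<in> space (M n). \<bar>SUP s. ereal \<bar>f n (sample t n \<omega>) s\<bar>\<bar> > ereal K0} \<le> ennreal \<rho>"
        using f_bdd \<open>0 < \<rho>\<close> unfolding stochastically_bounded_def by blast
      define K where "K = max K0 0"
      have "D ?F n \<le> D ?J n + (\<eta> + 1 / (real n + 1) + K * \<epsilon> + a \<epsilon> n / \<eta> + \<rho>) \<and>
          D ?J n \<le> D ?F n + (\<eta> + 1 / (real n + 1) + K * \<epsilon> + a \<epsilon> n / \<eta> + \<rho>)"
        if n: "2 \<le> n" and "0 < \<eta>" "0 \<le> \<epsilon>" for n \<eta> \<epsilon>
      proof -
        interpret iid_model Y p A n "M n" "P n" t \<kappa>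
          by (rule model[OF n])
        have n1: "1 \<le> n"
          using n by simp
        let ?U = "{\<omega> \<in> space (M n). \<bar>SUP s. ereal \<bar>f n (sample t n \<omega>) s\<bar>\<bar> > ereal K0}"
        \<comment> \<open>a measurable hull, because the supremum of the density need not be measurable\<close>
        obtain E where E: "E \<in> sets (M n)" "?U \<subseteq> E" "outer_measure_of (M n) ?U = emeasure (M n) E"
          using outer_measure_of_attain[of ?U "M n"] by auto
        have "ennreal (prob E) \<le> ennreal \<rho>"
          using K0[OF n1] E(3) by (simp add: emeasure_eq_measure)
        then have prob_E: "prob E \<le> \<rho>"
          using \<open>0 < \<rho>\<close> by simp
        have "AE \<omega> in M n. \<omega> \<notin> E \<longrightarrow> (\<exists>g. distributed (\<kappa> n (sample t n \<omega>)) lborel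
            (\<lambda>z. in_sample_score (B_alg A) n n z (sample t n \<omega>)) (\<lambda>s. ennreal (g s)) \<and> (\<forall>s. g s \<le> K))"
          using f[OF n1, unfolded C_def] AE_space
        proof eventually_elim
          case (elim \<omega>)
          have "f n (sample t n \<omega>) s \<le> K" if "\<omega> \<notin> E" for s
          proof -
            have "ereal \<bar>f n (sample t n \<omega>) s\<bar> \<le> (SUP s. ereal \<bar>f n (sample t n \<omega>) s\<bar>)"
              by (rule SUP_upper) simp
            also have "\<dots> \<le> \<bar>SUP s. ereal \<bar>f n (sample t n \<omega>) s\<bar>\<bar>"
              by (cases "SUP s. ereal \<bar>f n (sample t n \<omega>) s\<bar>") auto
            also have "\<dots> \<le> ereal K0"
              using that E(2) elim(2) by (auto simp: not_less[symmetric])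
            finally show ?thesis
              by (simp add: K_def)
          qed
          then show ?case
            using elim(1) by blast
        qed
        note dev = expectation_deviation_le[OF \<open>0 < \<eta>\<close> \<open>0 \<le> \<epsilon>\<close> _ E(1) this, unfolded deviation_def a_model[OF n]]
        have "0 \<le> K" by (simp add: K_def)
        show ?thesis
          using dev[OF \<open>0 \<le> K\<close>] prob_E unfolding D_def C_def by linarith
      qed
      moreover have "0 \<le> K" by (simp add: K_def)
      ultimately show ?thesis by blast
    qed
    have transfer: "D PS \<longlonglongrightarrow> 0"
      if PS': "D PS' \<longlonglongrightarrow> 0"
        and le: "\<And>\<rho>. 0 < \<rho> \<Longrightarrow> \<exists>K\<ge>0. \<forall>n\<ge>2. \<forall>\<eta>>0. \<forall>\<epsilon>\<ge>0.
          D PS n \<le> D PS' n + (\<eta> + 1 / (real n + 1) + K * \<epsilon> + a \<epsilon> n / \<eta> + \<rho>)" for PS PS'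
    proof (rule order_tendstoI)
      fix r :: real assume "r < 0"
      show "\<forall>\<^sub>F n in sequentially. r < D PS n"
        using eventually_ge_at_top[of 2] by eventually_elim (rule less_le_trans[OF \<open>r < 0\<close> D_nonneg])
    next
      fix r :: real assume "0 < r"
      then obtain K where K: "0 \<le> K" and le_K: "\<And>n \<eta> \<epsilon>. 2 \<le> n \<Longrightarrow> 0 < \<eta> \<Longrightarrow> 0 \<le> \<epsilon> \<Longrightarrow>
          D PS n \<le> D PS' n + (\<eta> + 1 / (real n + 1) + K * \<epsilon> + a \<epsilon> n / \<eta> + r / 4)"
        using le[of "r / 4"] by auto
      define \<epsilon> where "\<epsilon> = r / 4 / (K + 1)"
      have "0 < \<epsilon>" using \<open>0 < r\<close> K by (simp add: \<epsilon>_def)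
      have "K * \<epsilon> \<le> (K + 1) * \<epsilon>" using \<open>0 < \<epsilon>\<close> by simp
      also have "\<dots> = r / 4"
      proof -
        have "K + 1 \<noteq> 0" using K by simp
        then show ?thesis
          unfolding \<epsilon>_def times_divide_eq_right[of "K + 1" "r / 4" "K + 1"]
          by (rule nonzero_mult_div_cancel_left)
      qed
      finally have K\<epsilon>: "K * \<epsilon> \<le> r / 4" .
      have "(\<lambda>n. D PS' n + (r / 4 + 1 / (real n + 1) + K * \<epsilon> + a \<epsilon> n / (r / 4) + r / 4))
          \<longlonglongrightarrow> 0 + (r / 4 + 0 + K * \<epsilon> + 0 / (r / 4) + r / 4)"
        using \<open>0 < r\<close> by (intro tendsto_add tendsto_divide tendsto_const PS' lim_n a_lim \<open>0 < \<epsilon>\<close>) simp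
      then have "\<forall>\<^sub>F n in sequentially.
          D PS' n + (r / 4 + 1 / (real n + 1) + K * \<epsilon> + a \<epsilon> n / (r / 4) + r / 4) < r"
        using K\<epsilon> \<open>0 < r\<close> by (elim order_tendstoD(2)) simp
      then show "\<forall>\<^sub>F n in sequentially. D PS n < r"
        using eventually_ge_at_top[of 2]
      proof eventually_elim
        case (elim n)
        then show ?case
          using le_K[of n "r / 4" \<epsilon>] \<open>0 < r\<close> \<open>0 < \<epsilon>\<close> by simp
      qed
    qed
    have "D ?F \<longlonglongrightarrow> 0" if "D ?J \<longlonglongrightarrow> 0"
    proof (rule transfer[OF that])
      fix \<rho> :: real assume "0 < \<rho>"
      from D_le[OF this] show "\<exists>K\<ge>0. \<forall>n\<ge>2. \<forall>\<eta>>0. \<forall>\<epsilon>\<ge>0.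
          D ?F n \<le> D ?J n + (\<eta> + 1 / (real n + 1) + K * \<epsilon> + a \<epsilon> n / \<eta> + \<rho>)"
        by (elim ex_forward conj_forward all_forward imp_forward) (assumption | erule conjunct1)+
    qed
    moreover have "D ?J \<longlonglongrightarrow> 0" if "D ?F \<longlonglongrightarrow> 0"
    proof (rule transfer[OF that])
      fix \<rho> :: real assume "0 < \<rho>"
      from D_le[OF this] show "\<exists>K\<ge>0. \<forall>n\<ge>2. \<forall>\<eta>>0. \<forall>\<epsilon>\<ge>0.
          D ?J n \<le> D ?F n + (\<eta> + 1 / (real n + 1) + K * \<epsilon> + a \<epsilon> n / \<eta> + \<rho>)"
        by (elim ex_forward conj_forward all_forward imp_forward) (assumption | erule conjunct2)+
    qed
    ultimately show ?thesis
      unfolding asymp_D by blast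
  qed

  ultimately show ?thesis by blast
qed

end
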